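(* For any modules $M$ and $N$, $d_{EN}(M,N)\leq d_I(M,N)\leq 2d_{EN}(M,N)$. In particular, for all $\epsilon,\delta\ge0$: (i) if $M$ and $N$ are $\epsilon$-interleaved, then there is a module $Q$ with $Q\in \mathrm{EN}_\epsilon(M)$ and $Q\in \mathrm{EN}_\epsilon(N)$; and (ii) if there is a module $Q$ with $Q\in \mathrm{EN}_\epsilon(M)$ and $Q\in \mathrm{EN}_\delta(N)$, then $M$ and $N$ are $(\epsilon+\delta)$-interleaved.
   Context: Fix a field $k$. $\mathbb{P}$ is a poset (regarded as a category) equipped with functions $\mathbb{P}_\epsilon\colon\mathbb{P}\to\mathbb{P}$ for all $\epsilon\in\mathbb{R}$ such that $\mathbb{P}_0=\mathrm{id}$; $p\le q$ implies $\mathbb{P}_\epsilon(p)\le\mathbb{P}_\epsilon(q)$; $\mathbb{P}_\epsilon(p)\ge p$ for $\epsilon\ge0$; and $\mathbb{P}_{\epsilon+\delta}=\mathbb{P}_\epsilon\circ\mathbb{P}_\delta$. A module is a functor $M\colon\mathbb{P}\to\mathbf{Vec}_k$, with vector spaces $M_p$ and maps $M_{p\to q}$ for $p\le q$; morphisms are natural transformations. The shift $M(\epsilon)$ is given by $M(\epsilon)_p=M_{\mathbb{P}_\epsilon(p)}$, $M(\epsilon)_{p\to q}=M_{\mathbb{P}_\epsilon(p)\to\mathbb{P}_\epsilon(q)}$; for a morphism $f$, $f(\epsilon)_p=f_{\mathbb{P}_\epsilon(p)}$. For $\epsilon\le\delta$, $M_{\epsilon\to\delta}\colon M(\epsilon)\to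 M(\delta)$ is the morphism with $(M_{\epsilon\to\delta})_p=M_{\mathbb{P}_\epsilon(p)\to\mathbb{P}_\delta(p)}$. $M$ and $N$ are $\epsilon$-interleaved ($\epsilon\ge0$) if there are morphisms $\phi\colon M\to N(\epsilon)$, $\psi\colon N\to M(\epsilon)$ with $\psi(\epsilon)\circ\phi=M_{0\to2\epsilon}$ and $\phi(\epsilon)\circ\psi=N_{0\to2\epsilon}$. The interleaving distance is $d_I(M,N)=\inf\{\epsilon\mid M,N\text{ are }\epsilon\text{-interleaved}\}\in[0,\infty]$. For $\epsilon\ge0$ let $\mathrm{Im}_\epsilon(M)=\operatorname{im}(M_{-\epsilon\to0})\subseteq M$ and $\mathrm{Ker}_\epsilon(M)=\ker(M_{0\to\epsilon})\subseteq M$. $\mathrm{EN}_\epsilon(M)$ is the collection of modules isomorphic to some $M_1/M_2$ with $M_2\subseteq M_1\subseteq M$ submodules, $\mathrm{Im}_\epsilon(M)\subseteq M_1$ and $M_2\subseteq\mathrm{Ker}_\epsilon(M)$. The erosion neighborhood distance is $d_{EN}(M,N)=\inf\{\epsilon\ge0\mid \text{there is a module } Q \text{ with } Q\in\mathrm{EN}_\epsilon(M)\text{ and }Q\in\mathrm{EN}_\epsilon(N)\}\in[0,\infty]$. *)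

theory Defs
  imports "HOL-Library.Extended_Nonnegative_Real" "HOL-Algebra.QuotRing" "HOL-Algebra.Module"
begin

text \<open>Vector spaces over a field \<open>K\<close> are modules in the sense of the locale \<^locale>\<open>module\<close>.
  All maps are functions on the whole carrier type; only their values on carriers matter, so
  equality of morphisms is always equality on carriers.\<close>

section \<open>The poset and its translations\<close>

locale poset_flow =
  fixes S :: "real \<Rightarrow> 'p::order \<Rightarrow> 'p"
  assumes flow_zero: "S 0 = id"
    and flow_mono: "p \<le> q \<Longrightarrow> S \<epsilon> p \<le> S \<epsilon> q"
    and flow_ge: "0 \<le> \<epsilon> \<Longrightarrow> p \<le> S \<epsilon> p"
    and flow_add: "S (\<epsilon> + \<delta>) = S \<epsilon> \<circ> S \<delta>"

section \<open>Persistence modules and their morphisms\<close>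

definition linear_maps ::
    "('k, 'm) ring_scheme \<Rightarrow> ('k, 'a) module \<Rightarrow> ('k, 'b) module \<Rightarrow> ('a \<Rightarrow> 'b) set" where
  "linear_maps K V W = {f \<in> hom (add_monoid V) (add_monoid W).
     \<forall>a\<in>carrier K. \<forall>x\<in>carrier V. f (a \<odot>\<^bsub>V\<^esub> x) = a \<odot>\<^bsub>W\<^esub> f x}"

record ('p, 'k, 'a) pmod =
  obj :: "'p \<Rightarrow> ('k, 'a) module"
  arr :: "'p \<Rightarrow> 'p \<Rightarrow> 'a \<Rightarrow> 'a"

text \<open>Functors from the poset to vector spaces; \<open>arr M p q\<close> is meaningful only for \<open>p \<le> q\<close>.\<close>

definition pmodule :: "('k, 'm) ring_scheme \<Rightarrow> ('p::order, 'k, 'a) pmod \<Rightarrow> bool" where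
  "pmodule K M \<longleftrightarrow>
     (\<forall>p. module K (obj M p)) \<and>
     (\<forall>p q. p \<le> q \<longrightarrow> arr M p q \<in> linear_maps K (obj M p) (obj M q)) \<and>
     (\<forall>p. \<forall>x\<in>carrier (obj M p). arr M p p x = x) \<and>
     (\<forall>p q r. p \<le> q \<longrightarrow> q \<le> r \<longrightarrow>
        (\<forall>x\<in>carrier (obj M p). arr M q r (arr M p q x) = arr M p r x))"

definition morphism ::
    "('k, 'm) ring_scheme \<Rightarrow> ('p::order, 'k, 'a) pmod \<Rightarrow> ('p, 'k, 'b) pmod
      \<Rightarrow> ('p \<Rightarrow> 'a \<Rightarrow> 'b) \<Rightarrow> bool" where
  "morphism K M N f \<longleftrightarrow>
     (\<forall>p. f p \<in> linear_maps K (obj M p) (obj N p)) \<and>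
     (\<forall>p q. p \<le> q \<longrightarrow> (\<forall>x\<in>carrier (obj M p). f q (arr M p q x) = arr N p q (f p x)))"

definition mor_comp :: "('p \<Rightarrow> 'b \<Rightarrow> 'c) \<Rightarrow> ('p \<Rightarrow> 'a \<Rightarrow> 'b) \<Rightarrow> 'p \<Rightarrow> 'a \<Rightarrow> 'c" where
  "mor_comp g f = (\<lambda>p. g p \<circ> f p)"

definition mor_id :: "'p \<Rightarrow> 'a \<Rightarrow> 'a" where
  "mor_id = (\<lambda>p x. x)"

text \<open>Equality of morphisms with source \<open>M\<close>.\<close>

definition mor_eq ::
    "('p, 'k, 'a) pmod \<Rightarrow> ('p \<Rightarrow> 'a \<Rightarrow> 'b) \<Rightarrow> ('p \<Rightarrow> 'a \<Rightarrow> 'b) \<Rightarrow> bool" where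
  "mor_eq M f g \<longleftrightarrow> (\<forall>p. \<forall>x\<in>carrier (obj M p). f p x = g p x)"

definition isomorphic_pmod ::
    "('k, 'm) ring_scheme \<Rightarrow> ('p::order, 'k, 'a) pmod \<Rightarrow> ('p, 'k, 'b) pmod \<Rightarrow> bool" where
  "isomorphic_pmod K M N \<longleftrightarrow> (\<exists>f g. morphism K M N f \<and> morphism K N M g \<and>
     mor_eq M (mor_comp g f) mor_id \<and> mor_eq N (mor_comp f g) mor_id)"

section \<open>Shifts and interleavings\<close>

definition shift :: "(real \<Rightarrow> 'p \<Rightarrow> 'p) \<Rightarrow> real \<Rightarrow> ('p, 'k, 'a) pmod \<Rightarrow> ('p, 'k, 'a) pmod" where
  "shift S \<epsilon> M = \<lparr>obj = (\<lambda>p. obj M (S \<epsilon> p)), arr = (\<lambda>p q. arr M (S \<epsilon> p) (S \<epsilon> q))\<rparr>"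

definition shift_mor ::
    "(real \<Rightarrow> 'p \<Rightarrow> 'p) \<Rightarrow> real \<Rightarrow> ('p \<Rightarrow> 'a \<Rightarrow> 'b) \<Rightarrow> 'p \<Rightarrow> 'a \<Rightarrow> 'b" where
  "shift_mor S \<epsilon> f = (\<lambda>p. f (S \<epsilon> p))"

text \<open>The morphism \<open>M(\<epsilon>) \<rightarrow> M(\<delta>)\<close>, for \<open>\<epsilon> \<le> \<delta>\<close>.\<close>

definition transition ::
    "(real \<Rightarrow> 'p \<Rightarrow> 'p) \<Rightarrow> ('p, 'k, 'a) pmod \<Rightarrow> real \<Rightarrow> real \<Rightarrow> 'p \<Rightarrow> 'a \<Rightarrow> 'a" where
  "transition S M \<epsilon> \<delta> = (\<lambda>p. arr M (S \<epsilon> p) (S \<delta> p))"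

definition interleaved ::
    "('k, 'm) ring_scheme \<Rightarrow> (real \<Rightarrow> 'p::order \<Rightarrow> 'p) \<Rightarrow> real
      \<Rightarrow> ('p, 'k, 'a) pmod \<Rightarrow> ('p, 'k, 'b) pmod \<Rightarrow> bool" where
  "interleaved K S \<epsilon> M N \<longleftrightarrow> 0 \<le> \<epsilon> \<and>
     (\<exists>\<phi> \<psi>. morphism K M (shift S \<epsilon> N) \<phi> \<and> morphism K N (shift S \<epsilon> M) \<psi> \<and>
        mor_eq M (mor_comp (shift_mor S \<epsilon> \<psi>) \<phi>) (transition S M 0 (2 * \<epsilon>)) \<and>
        mor_eq N (mor_comp (shift_mor S \<epsilon> \<phi>) \<psi>) (transition S N 0 (2 * \<epsilon>)))"

definition d_I ::
    "('k, 'm) ring_scheme \<Rightarrow> (real \<Rightarrow> 'p::order \<Rightarrow> 'p)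
      \<Rightarrow> ('p, 'k, 'a) pmod \<Rightarrow> ('p, 'k, 'b) pmod \<Rightarrow> ennreal" where
  "d_I K S M N = (INF \<epsilon>\<in>{\<epsilon>. interleaved K S \<epsilon> M N}. ennreal \<epsilon>)"

section \<open>Submodules and quotients\<close>

definition sub_pmod ::
    "('k, 'm) ring_scheme \<Rightarrow> ('p::order, 'k, 'a) pmod \<Rightarrow> ('p \<Rightarrow> 'a set) \<Rightarrow> bool" where
  "sub_pmod K M U \<longleftrightarrow> (\<forall>p. submodule (U p) K (obj M p)) \<and>
     (\<forall>p q. p \<le> q \<longrightarrow> arr M p q ` U p \<subseteq> U q)"

definition restrict_pmod :: "('p, 'k, 'a) pmod \<Rightarrow> ('p \<Rightarrow> 'a set) \<Rightarrow> ('p, 'k, 'a) pmod" where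
  "restrict_pmod M U = \<lparr>obj = (\<lambda>p. (obj M p)\<lparr>carrier := U p\<rparr>), arr = arr M\<rparr>"

text \<open>The analogue for vector spaces of \<^const>\<open>FactRing\<close>. The components \<open>mult\<close> and \<open>one\<close>,
  inherited by the record type from rings, play no role in the locale \<^locale>\<open>module\<close>. The union in \<open>smult\<close>, and in \<open>arr\<close> of
  \<open>quot_pmod\<close> below, is over the representatives of a coset, all of which yield the same
  coset.\<close>

definition quot_space :: "('k, 'a) module \<Rightarrow> 'a set \<Rightarrow> ('k, 'a set) module" where
  "quot_space V W = \<lparr>carrier = a_rcosets\<^bsub>V\<^esub> W, mult = undefined, one = undefined,
     zero = W, add = set_add V, smult = (\<lambda>a X. \<Union>x\<in>X. W +>\<^bsub>V\<^esub> (a \<odot>\<^bsub>V\<^esub> x))\<rparr>"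

definition quot_pmod :: "('p, 'k, 'a) pmod \<Rightarrow> ('p \<Rightarrow> 'a set) \<Rightarrow> ('p, 'k, 'a set) pmod" where
  "quot_pmod M U = \<lparr>obj = (\<lambda>p. quot_space (obj M p) (U p)),
     arr = (\<lambda>p q X. \<Union>x\<in>X. U q +>\<^bsub>obj M q\<^esub> arr M p q x)\<rparr>"

section \<open>Erosion neighborhoods\<close>

definition Im_sub ::
    "(real \<Rightarrow> 'p \<Rightarrow> 'p) \<Rightarrow> real \<Rightarrow> ('p, 'k, 'a) pmod \<Rightarrow> 'p \<Rightarrow> 'a set" where
  "Im_sub S \<epsilon> M = (\<lambda>p. transition S M (- \<epsilon>) 0 p ` carrier (obj (shift S (- \<epsilon>) M) p))"

definition Ker_sub ::
    "(real \<Rightarrow> 'p \<Rightarrow> 'p) \<Rightarrow> real \<Rightarrow> ('p, 'k, 'a) pmod \<Rightarrow> 'p \<Rightarrow> 'a set" where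
  "Ker_sub S \<epsilon> M = (\<lambda>p. a_kernel (obj M p) (obj (shift S \<epsilon> M) p) (transition S M 0 \<epsilon> p))"

definition EN ::
    "('k, 'm) ring_scheme \<Rightarrow> (real \<Rightarrow> 'p::order \<Rightarrow> 'p) \<Rightarrow> real
      \<Rightarrow> ('p, 'k, 'a) pmod \<Rightarrow> ('p, 'k, 'c) pmod set" where
  "EN K S \<epsilon> M = {Q. pmodule K Q \<and>
     (\<exists>M\<^sub>1 M\<^sub>2. sub_pmod K M M\<^sub>1 \<and> sub_pmod K M M\<^sub>2 \<and> (\<forall>p. M\<^sub>2 p \<subseteq> M\<^sub>1 p) \<and>
        (\<forall>p. Im_sub S \<epsilon> M p \<subseteq> M\<^sub>1 p) \<and> (\<forall>p. M\<^sub>2 p \<subseteq> Ker_sub S \<epsilon> M p) \<and>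
        isomorphic_pmod K Q (quot_pmod (restrict_pmod M M\<^sub>1) M\<^sub>2))}"

text \<open>An existential quantifier in HOL cannot range over modules of all carrier types. The one
  below ranges over modules with elements of type \<open>'a set\<close>, the type where the quotients of
  submodules of \<open>M\<close> live; by the lemma \<open>EN_carrier_type\<close> below this is no restriction.\<close>

definition d_EN ::
    "('k, 'm) ring_scheme \<Rightarrow> (real \<Rightarrow> 'p::order \<Rightarrow> 'p)
      \<Rightarrow> ('p, 'k, 'a) pmod \<Rightarrow> ('p, 'k, 'b) pmod \<Rightarrow> ennreal" where
  "d_EN K S M N = (INF \<epsilon>\<in>{\<epsilon>. 0 \<le> \<epsilon> \<and>
     (\<exists>Q :: ('p, 'k, 'a set) pmod. Q \<in> EN K S \<epsilon> M \<and> Q \<in> EN K S \<epsilon> N)}. ennreal \<epsilon>)"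

subsection \<open>Independence of the carrier type\<close>

lemma linear_mapsD:
  assumes "f \<in> linear_maps K V W"
  shows "\<And>x. x \<in> carrier V \<Longrightarrow> f x \<in> carrier W"
    and "\<And>x y. x \<in> carrier V \<Longrightarrow> y \<in> carrier V \<Longrightarrow> f (x \<oplus>\<^bsub>V\<^esub> y) = f x \<oplus>\<^bsub>W\<^esub> f y"
    and "\<And>a x. a \<in> carrier K \<Longrightarrow> x \<in> carrier V \<Longrightarrow> f (a \<odot>\<^bsub>V\<^esub> x) = a \<odot>\<^bsub>W\<^esub> f x"
  using assms by (auto simp: linear_maps_def hom_def)

lemma linear_mapsI:
  assumes "\<And>x. x \<in> carrier V \<Longrightarrow> f x \<in> carrier W"
    and "\<And>x y. x \<in> carrier V \<Longrightarrow> y \<in> carrier V \<Longrightarrow> f (x \<oplus>\<^bsub>V\<^esub> y) = f x \<oplus>\<^bsub>W\<^esub> f y"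
    and "\<And>a x. a \<in> carrier K \<Longrightarrow> x \<in> carrier V \<Longrightarrow> f (a \<odot>\<^bsub>V\<^esub> x) = a \<odot>\<^bsub>W\<^esub> f x"
  shows "f \<in> linear_maps K V W"
  using assms by (auto simp: linear_maps_def hom_def)

lemma linear_maps_comp:
  "f \<in> linear_maps K U V \<Longrightarrow> g \<in> linear_maps K V W \<Longrightarrow> g \<circ> f \<in> linear_maps K U W"
  by (rule linear_mapsI) (simp_all add: linear_mapsD)

lemma morphismD:
  assumes "morphism K M N f"
  shows "f p \<in> linear_maps K (obj M p) (obj N p)"
    and "x \<in> carrier (obj M p) \<Longrightarrow> f p x \<in> carrier (obj N p)"
    and "p \<le> q \<Longrightarrow> x \<in> carrier (obj M p) \<Longrightarrow> f q (arr M p q x) = arr N p q (f p x)"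
proof -
  show lin: "f p \<in> linear_maps K (obj M p) (obj N p)"
    using assms by (simp add: morphism_def)
  show "x \<in> carrier (obj M p) \<Longrightarrow> f p x \<in> carrier (obj N p)"
    by (rule linear_mapsD(1)[OF lin])
  show "p \<le> q \<Longrightarrow> x \<in> carrier (obj M p) \<Longrightarrow> f q (arr M p q x) = arr N p q (f p x)"
    using assms by (simp add: morphism_def)
qed

lemma morphism_comp:
  assumes f: "morphism K L M f" and g: "morphism K M N g"
  shows "morphism K L N (mor_comp g f)"
  using morphismD[OF f] morphismD[OF g]
  by (simp add: morphism_def mor_comp_def linear_maps_comp[OF morphismD(1)[OF f] morphismD(1)[OF g]])

lemma isomorphic_pmod_sym: "isomorphic_pmod K M N \<Longrightarrow> isomorphic_pmod K N M"
  unfolding isomorphic_pmod_def by blast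

lemma isomorphic_pmod_trans:
  assumes "isomorphic_pmod K L M" "isomorphic_pmod K M N"
  shows "isomorphic_pmod K L N"
proof -
  obtain f g where fg: "morphism K L M f" "morphism K M L g"
      "mor_eq L (mor_comp g f) mor_id" "mor_eq M (mor_comp f g) mor_id"
    using assms(1) unfolding isomorphic_pmod_def by blast
  obtain h k where hk: "morphism K M N h" "morphism K N M k"
      "mor_eq M (mor_comp k h) mor_id" "mor_eq N (mor_comp h k) mor_id"
    using assms(2) unfolding isomorphic_pmod_def by blast
  have "mor_eq L (mor_comp (mor_comp g k) (mor_comp h f)) mor_id"
       "mor_eq N (mor_comp (mor_comp h f) (mor_comp g k)) mor_id"
    using fg hk morphismD(2)[OF fg(1)] morphismD(2)[OF hk(2)]
    by (simp_all add: mor_eq_def mor_comp_def mor_id_def)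
  then show ?thesis
    unfolding isomorphic_pmod_def
    using morphism_comp[OF fg(1) hk(1)] morphism_comp[OF hk(2) fg(2)] by blast
qed

locale quot_setup = module K V for K :: "('k, 'm) ring_scheme" and V :: "('k, 'a) module" +
  fixes W :: "'a set"
  assumes sub: "submodule W K V"
begin

sublocale W: abelian_subgroup W V
  using sub by (intro abelian_subgroupI3 additive_subgroup.intro M.abelian_group_axioms)
    (simp add: submodule_def)

lemma coset_eq_iff:
  assumes "x \<in> carrier V" "y \<in> carrier V"
  shows "W +>\<^bsub>V\<^esub> x = W +>\<^bsub>V\<^esub> y \<longleftrightarrow> x \<oplus>\<^bsub>V\<^esub> \<ominus>\<^bsub>V\<^esub> y \<in> W"
  using assms W.a_rcos_module W.a_rcos_self W.a_repr_independence' by metis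

lemma carrier_quot: "carrier (quot_space V W) = (\<lambda>x. W +>\<^bsub>V\<^esub> x) ` carrier V"
  by (auto simp: quot_space_def A_RCOSETS_def')

lemma UN_coset:
  assumes x: "x \<in> carrier V"
    and c: "\<And>y. y \<in> carrier V \<Longrightarrow> y \<oplus>\<^bsub>V\<^esub> \<ominus>\<^bsub>V\<^esub> x \<in> W \<Longrightarrow> F y = F x"
  shows "(\<Union>y\<in>W +>\<^bsub>V\<^esub> x. F y) = F x"
proof -
  have "F y = F x" if y: "y \<in> W +>\<^bsub>V\<^esub> x" for y
  proof -
    have "y \<in> carrier V" using W.a_elemrcos_carrier[OF x y] .
    with y x show ?thesis using c W.a_rcos_module by blast
  qed
  with W.a_rcos_self[OF x] show ?thesis by blast
qed

lemma quot_smult: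
  assumes a: "a \<in> carrier K" and x: "x \<in> carrier V"
  shows "a \<odot>\<^bsub>quot_space V W\<^esub> (W +>\<^bsub>V\<^esub> x) = W +>\<^bsub>V\<^esub> (a \<odot>\<^bsub>V\<^esub> x)"
proof -
  have "W +>\<^bsub>V\<^esub> (a \<odot>\<^bsub>V\<^esub> y) = W +>\<^bsub>V\<^esub> (a \<odot>\<^bsub>V\<^esub> x)"
    if y: "y \<in> carrier V" and d: "y \<oplus>\<^bsub>V\<^esub> \<ominus>\<^bsub>V\<^esub> x \<in> W" for y
  proof -
    have "a \<odot>\<^bsub>V\<^esub> (y \<oplus>\<^bsub>V\<^esub> \<ominus>\<^bsub>V\<^esub> x) \<in> W"
      using submoduleE(4)[OF sub] a d by blast
    moreover have "a \<odot>\<^bsub>V\<^esub> (y \<oplus>\<^bsub>V\<^esub> \<ominus>\<^bsub>V\<^esub> x) = a \<odot>\<^bsub>V\<^esub> y \<oplus>\<^bsub>V\<^esub> \<ominus>\<^bsub>V\<^esub> (a \<odot>\<^bsub>V\<^esub> x)"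
      using a x y by (simp add: smult_r_distr smult_r_minus)
    ultimately show ?thesis using a x y by (simp add: coset_eq_iff)
  qed
  then show ?thesis
    using UN_coset[OF x, of "\<lambda>y. W +>\<^bsub>V\<^esub> (a \<odot>\<^bsub>V\<^esub> y)"] by (simp add: quot_space_def)
qed

lemma quot_add:
  "x \<in> carrier V \<Longrightarrow> y \<in> carrier V \<Longrightarrow>
    (W +>\<^bsub>V\<^esub> x) \<oplus>\<^bsub>quot_space V W\<^esub> (W +>\<^bsub>V\<^esub> y) = W +>\<^bsub>V\<^esub> (x \<oplus>\<^bsub>V\<^esub> y)"
  using W.a_rcos_sum by (simp add: quot_space_def)

lemma module_quot: "module K (quot_space V W)"
proof (rule moduleI)
  show "cring K" by (rule R.is_cring)
  have zero: "\<zero>\<^bsub>quot_space V W\<^esub> = W +>\<^bsub>V\<^esub> \<zero>\<^bsub>V\<^esub>"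
    using W.a_rcos_const[OF W.zero_closed] by (simp add: quot_space_def)
  have "\<exists>y\<in>carrier V. (W +>\<^bsub>V\<^esub> y) \<oplus>\<^bsub>quot_space V W\<^esub> (W +>\<^bsub>V\<^esub> x) = W +>\<^bsub>V\<^esub> \<zero>\<^bsub>V\<^esub>"
    if "x \<in> carrier V" for x
    using that by (intro bexI[of _ "\<ominus>\<^bsub>V\<^esub> x"]) (simp_all add: quot_add M.l_neg)
  then show "abelian_group (quot_space V W)"
    by (intro abelian_groupI) (auto simp: carrier_quot quot_add zero M.a_ac)
qed (auto simp: carrier_quot quot_smult quot_add smult_l_distr smult_r_distr smult_assoc1)

end

lemma pmoduleD:
  assumes "pmodule K M"
  shows "module K (obj M p)"
    and "p \<le> q \<Longrightarrow> arr M p q \<in> linear_maps K (obj M p) (obj M q)"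
    and "x \<in> carrier (obj M p) \<Longrightarrow> arr M p p x = x"
    and "p \<le> q \<Longrightarrow> q \<le> r \<Longrightarrow> x \<in> carrier (obj M p) \<Longrightarrow> arr M q r (arr M p q x) = arr M p r x"
  using assms by (simp_all add: pmodule_def)

lemma pmodule_restrict:
  assumes M: "pmodule K M" and U: "sub_pmod K M U"
  shows "pmodule K (restrict_pmod M U)"
proof -
  have sub: "submodule (U p) K (obj M p)" for p using U by (simp add: sub_pmod_def)
  have U_carrier: "x \<in> carrier (obj M p)" if "x \<in> U p" for x p
    using module.submoduleE(1)[OF pmoduleD(1)[OF M] sub] that by blast
  have "arr M p q \<in> linear_maps K ((obj M p)\<lparr>carrier := U p\<rparr>) ((obj M q)\<lparr>carrier := U q\<rparr>)"
    if "p \<le> q" for p q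
    using linear_mapsD[OF pmoduleD(2)[OF M that]] U_carrier U that
    by (intro linear_mapsI) (auto simp: sub_pmod_def image_subset_iff)
  then show ?thesis
    using submodule.submodule_is_module[OF sub pmoduleD(1)[OF M]] pmoduleD(3,4)[OF M] U_carrier
    unfolding pmodule_def restrict_pmod_def by simp
qed

lemma pmodule_quot:
  assumes M: "pmodule K M" and U: "sub_pmod K M U"
  shows "pmodule K (quot_pmod M U)"
proof -
  have qs: "quot_setup K (obj M p) (U p)" for p
    using U pmoduleD(1)[OF M] by (simp add: quot_setup_def quot_setup_axioms_def sub_pmod_def)
  have car: "carrier (obj (quot_pmod M U) p) = (\<lambda>x. U p +>\<^bsub>obj M p\<^esub> x) ` carrier (obj M p)" for p
    using quot_setup.carrier_quot[OF qs] by (simp add: quot_pmod_def)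
  have arr: "arr (quot_pmod M U) p q (U p +>\<^bsub>obj M p\<^esub> x) = U q +>\<^bsub>obj M q\<^esub> arr M p q x"
    if pq: "p \<le> q" and x: "x \<in> carrier (obj M p)" for p q x
  proof -
    interpret P: quot_setup K "obj M p" "U p" by (rule qs)
    interpret Q: quot_setup K "obj M q" "U q" by (rule qs)
    interpret h: abelian_group_hom "obj M p" "obj M q" "arr M p q"
      using pmoduleD(2)[OF M pq]
      by (intro abelian_group_homI P.M.abelian_group_axioms Q.M.abelian_group_axioms group_hom.intro
          P.M.a_group Q.M.a_group group_hom_axioms.intro) (simp add: linear_maps_def)
    have "U q +>\<^bsub>obj M q\<^esub> arr M p q y = U q +>\<^bsub>obj M q\<^esub> arr M p q x"
      if y: "y \<in> carrier (obj M p)" and d: "y \<oplus>\<^bsub>obj M p\<^esub> \<ominus>\<^bsub>obj M p\<^esub> x \<in> U p" for y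
    proof -
      have "arr M p q (y \<oplus>\<^bsub>obj M p\<^esub> \<ominus>\<^bsub>obj M p\<^esub> x) \<in> U q"
        using U pq d unfolding sub_pmod_def by blast
      then show ?thesis using x y by (simp add: Q.coset_eq_iff)
    qed
    then show ?thesis
      using P.UN_coset[OF x, of "\<lambda>y. U q +>\<^bsub>obj M q\<^esub> arr M p q y"] by (simp add: quot_pmod_def)
  qed
  have add: "(U p +>\<^bsub>obj M p\<^esub> x) \<oplus>\<^bsub>obj (quot_pmod M U) p\<^esub> (U p +>\<^bsub>obj M p\<^esub> y)
      = U p +>\<^bsub>obj M p\<^esub> (x \<oplus>\<^bsub>obj M p\<^esub> y)"
    if "x \<in> carrier (obj M p)" "y \<in> carrier (obj M p)" for p x y
    using quot_setup.quot_add[OF qs that] by (simp add: quot_pmod_def)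
  have smult: "a \<odot>\<^bsub>obj (quot_pmod M U) p\<^esub> (U p +>\<^bsub>obj M p\<^esub> x) = U p +>\<^bsub>obj M p\<^esub> (a \<odot>\<^bsub>obj M p\<^esub> x)"
    if "a \<in> carrier K" "x \<in> carrier (obj M p)" for p a x
    using quot_setup.quot_smult[OF qs that] by (simp add: quot_pmod_def)
  have lin: "arr (quot_pmod M U) p q
      \<in> linear_maps K (obj (quot_pmod M U) p) (obj (quot_pmod M U) q)" if pq: "p \<le> q" for p q
  proof -
    interpret P: module K "obj M p" by (rule pmoduleD(1)[OF M])
    show ?thesis
      using linear_mapsD[OF pmoduleD(2)[OF M pq]]
      by (intro linear_mapsI) (auto simp: car arr[OF pq] add smult)
  qed
  have idn: "arr (quot_pmod M U) p p X = X" if X: "X \<in> carrier (obj (quot_pmod M U) p)" for p X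
  proof -
    obtain x where "x \<in> carrier (obj M p)" "X = U p +>\<^bsub>obj M p\<^esub> x" using X car by blast
    then show ?thesis by (simp add: arr pmoduleD(3)[OF M])
  qed
  have cmp: "arr (quot_pmod M U) q r (arr (quot_pmod M U) p q X) = arr (quot_pmod M U) p r X"
    if pq: "p \<le> q" and qr: "q \<le> r" and X: "X \<in> carrier (obj (quot_pmod M U) p)" for p q r X
  proof -
    obtain x where x: "x \<in> carrier (obj M p)" "X = U p +>\<^bsub>obj M p\<^esub> x" using X car by blast
    then have "arr M p q x \<in> carrier (obj M q)"
      using linear_mapsD(1)[OF pmoduleD(2)[OF M pq]] by blast
    with x pq qr order_trans[OF pq qr] show ?thesis
      by (simp add: arr pmoduleD(4)[OF M pq qr])
  qed
  have "module K (obj (quot_pmod M U) p)" for p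
    using quot_setup.module_quot[OF qs] by (simp add: quot_pmod_def)
  then show ?thesis
    using lin idn cmp by (simp add: pmodule_def)
qed

lemma sub_pmod_restrict:
  assumes M: "pmodule K M" and U: "sub_pmod K M U" and W: "sub_pmod K M W"
    and WU: "\<And>p. W p \<subseteq> U p"
  shows "sub_pmod K (restrict_pmod M U) W"
proof -
  have "submodule (W p) K ((obj M p)\<lparr>carrier := U p\<rparr>)" for p
  proof (rule module.module_incl_imp_submodule)
    show "module K ((obj M p)\<lparr>carrier := U p\<rparr>)"
      using pmoduleD(1)[OF pmodule_restrict[OF M U], of p] by (simp add: restrict_pmod_def)
    show "module K ((obj M p)\<lparr>carrier := U p\<rparr>\<lparr>carrier := W p\<rparr>)"
      using pmoduleD(1)[OF pmodule_restrict[OF M W], of p] by (simp add: restrict_pmod_def)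
  qed (use WU in simp)
  then show ?thesis using W by (simp add: sub_pmod_def restrict_pmod_def)
qed

lemma EN_cong:
  fixes M :: "('p::order, 'k, 'a) pmod"
  assumes "isomorphic_pmod K Q Q'" "pmodule K Q'" "Q \<in> EN K S \<epsilon> M"
  shows "Q' \<in> EN K S \<epsilon> M"
proof -
  obtain M\<^sub>1 M\<^sub>2 where "sub_pmod K M M\<^sub>1" "sub_pmod K M M\<^sub>2" "\<forall>p. M\<^sub>2 p \<subseteq> M\<^sub>1 p"
      "\<forall>p. Im_sub S \<epsilon> M p \<subseteq> M\<^sub>1 p" "\<forall>p. M\<^sub>2 p \<subseteq> Ker_sub S \<epsilon> M p"
    and iso: "isomorphic_pmod K Q (quot_pmod (restrict_pmod M M\<^sub>1) M\<^sub>2)"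
    using assms(3) unfolding EN_def mem_Collect_eq by blast
  moreover note isomorphic_pmod_trans[OF isomorphic_pmod_sym[OF assms(1)] iso]
  ultimately show ?thesis
    using assms(2) unfolding EN_def mem_Collect_eq by (intro conjI exI[of _ M\<^sub>1] exI[of _ M\<^sub>2])
qed

lemma EN_carrier_type:
  fixes M :: "('p::order, 'k, 'a) pmod" and N :: "('p, 'k, 'b) pmod" and Q :: "('p, 'k, 'c) pmod"
  assumes "pmodule K M" and "Q \<in> EN K S \<epsilon> M" and "Q \<in> EN K S \<delta> N"
  shows "\<exists>Q' :: ('p, 'k, 'a set) pmod. Q' \<in> EN K S \<epsilon> M \<and> Q' \<in> EN K S \<delta> N"
proof -
  obtain M\<^sub>1 M\<^sub>2 where M12: "sub_pmod K M M\<^sub>1" "sub_pmod K M M\<^sub>2" "\<forall>p. M\<^sub>2 p \<subseteq> M\<^sub>1 p"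
    and iso: "isomorphic_pmod K Q (quot_pmod (restrict_pmod M M\<^sub>1) M\<^sub>2)"
    using assms(2) unfolding EN_def mem_Collect_eq by blast
  have pm: "pmodule K (quot_pmod (restrict_pmod M M\<^sub>1) M\<^sub>2)"
    using M12 assms(1) by (intro pmodule_quot pmodule_restrict sub_pmod_restrict) auto
  show ?thesis
    using EN_cong[OF iso pm assms(2)] EN_cong[OF iso pm assms(3)] by blast
qed

end

theory Submission
  imports Defs
begin

text \<open>The proof passes through correspondences: families of submodules
  \<open>R p \<subseteq> M p \<oplus> N p\<close> that are preserved by the structure maps. Interleavings and
  common subquotients are both compared with correspondences of bounded indeterminacy.

  By Goursat's lemma, \<open>R\<close> induces an isomorphism between the subquotient of \<open>M\<close> with numerator
  the domain of \<open>R\<close> and denominator \<open>{m. (m, 0) \<in> R p}\<close>, and the analogous subquotient of \<open>N\<close>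
  (\<open>quotients_isomorphic\<close>). Conversely, every module isomorphic to a subquotient of \<open>M\<close> and to
  one of \<open>N\<close> relates the elements of \<open>M\<close> and \<open>N\<close> that represent the same element of it. So a
  common element of \<open>EN K S \<epsilon> M\<close> and \<open>EN K S \<delta> N\<close> amounts to a correspondence whose domain and
  range contain the images \<open>Im_sub\<close> and whose denominators lie in the kernels \<open>Ker_sub\<close>; this is
  the locale \<open>erosion_correspondence\<close>.

  From an \<open>\<epsilon>\<close>-interleaving \<open>\<phi>\<close>, \<open>\<psi>\<close> such a correspondence (with \<open>\<delta> = \<epsilon>\<close>) is the set
  of pairs \<open>(m, n)\<close> that become identified after a shift by \<open>\<epsilon>\<close> on either side: \<open>M\<^bsub>0\<rightarrow>\<epsilon>\<^esub> m = \<psi> n\<close> and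
  \<open>N\<^bsub>0\<rightarrow>\<epsilon>\<^esub> n = \<phi> m\<close>. An element of \<open>Im_sub S \<epsilon> M p\<close>, say the image of \<open>x\<close>, is
  related to \<open>\<phi> x\<close>, and if \<open>(m, 0)\<close> is in the relation, then \<open>M\<^bsub>0\<rightarrow>\<epsilon>\<^esub> m = \<psi> 0 = 0\<close>.

  In the other direction, a correspondence is a multivalued partial map. Shifting by \<open>\<epsilon>\<close> before
  applying it moves every \<open>m\<close> into its domain; shifting by \<open>\<delta>\<close> after applying it kills the
  indeterminacy of its values. The result is a morphism from \<open>M\<close> to \<open>N(\<epsilon> + \<delta>)\<close>, and with the
  one obtained from the converse relation it forms an \<open>(\<epsilon> + \<delta>)\<close>-interleaving.\<close>

section \<open>Zero elements and translations\<close>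

lemma linear_maps_zero:
  assumes "module K V" "module K W" "f \<in> linear_maps K V W"
  shows "f \<zero>\<^bsub>V\<^esub> = \<zero>\<^bsub>W\<^esub>"
proof -
  interpret V: module K V by fact
  interpret W: module K W by fact
  have "f (\<zero>\<^bsub>K\<^esub> \<odot>\<^bsub>V\<^esub> \<zero>\<^bsub>V\<^esub>) = \<zero>\<^bsub>K\<^esub> \<odot>\<^bsub>W\<^esub> f \<zero>\<^bsub>V\<^esub>"
    using linear_mapsD(3)[OF assms(3)] by blast
  then show ?thesis using linear_mapsD(1)[OF assms(3)] by simp
qed

lemma morphism_zero:
  assumes "pmodule K M" "pmodule K N" "morphism K M N f"
  shows "f p \<zero>\<^bsub>obj M p\<^esub> = \<zero>\<^bsub>obj N p\<^esub>"
  using linear_maps_zero pmoduleD(1)[OF assms(1)] pmoduleD(1)[OF assms(2)] morphismD(1)[OF assms(3)]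
  by blast

lemma arr_zero:
  assumes "pmodule K M" "p \<le> q"
  shows "arr M p q \<zero>\<^bsub>obj M p\<^esub> = \<zero>\<^bsub>obj M q\<^esub>"
  using linear_maps_zero pmoduleD(1)[OF assms(1)] pmoduleD(2)[OF assms] by blast

lemma isomorphic_pmod_refl: "pmodule K M \<Longrightarrow> isomorphic_pmod K M M"
  unfolding isomorphic_pmod_def
  by (intro exI[of _ mor_id])
    (auto simp: morphism_def mor_eq_def mor_comp_def mor_id_def intro: linear_mapsI)

lemma (in poset_flow) flow_flow: "S \<epsilon> (S \<delta> p) = S (\<epsilon> + \<delta>) p"
  by (simp add: flow_add)

lemma (in poset_flow) flow_zero_apply: "S 0 p = p"
  by (simp add: flow_zero)

lemma (in poset_flow) flow_le: "\<epsilon> \<le> \<delta> \<Longrightarrow> S \<epsilon> p \<le> S \<delta> p"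
  using flow_ge[of "\<delta> - \<epsilon>" "S \<epsilon> p"] by (simp add: flow_flow)

lemma (in poset_flow) Im_sub_iff:
  "x \<in> Im_sub S \<epsilon> M p \<longleftrightarrow> (\<exists>m\<in>carrier (obj M (S (- \<epsilon>) p)). x = arr M (S (- \<epsilon>) p) p m)"
  by (auto simp: Im_sub_def transition_def shift_def flow_zero_apply)

lemma (in poset_flow) Ker_sub_iff:
  "x \<in> Ker_sub S \<epsilon> M p \<longleftrightarrow>
     x \<in> carrier (obj M p) \<and> arr M p (S \<epsilon> p) x = \<zero>\<^bsub>obj M (S \<epsilon> p)\<^esub>"
  by (auto simp: Ker_sub_def a_kernel_def' transition_def shift_def flow_zero_apply)

section \<open>Subquotients\<close>

locale subquotient =
  fixes K :: "('k, 'm) ring_scheme" and M :: "('p::order, 'k, 'a) pmod"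
    and M\<^sub>1 M\<^sub>2 :: "'p \<Rightarrow> 'a set"
  assumes pmodule: "pmodule K M"
    and sub_num: "sub_pmod K M M\<^sub>1" and sub_den: "sub_pmod K M M\<^sub>2"
    and den_le_num: "M\<^sub>2 p \<subseteq> M\<^sub>1 p"
begin

abbreviation quot :: "('p, 'k, 'a set) pmod" where
  "quot \<equiv> quot_pmod (restrict_pmod M M\<^sub>1) M\<^sub>2"

text \<open>The coset is formed in \<open>M\<close> and not in the numerator. This makes no difference, since only the
  addition matters, and it keeps the restricted carriers out of the formulas.\<close>

abbreviation cls :: "'p \<Rightarrow> 'a \<Rightarrow> 'a set" where
  "cls p m \<equiv> M\<^sub>2 p +>\<^bsub>obj M p\<^esub> m"

lemma pmodule_subquotient: "pmodule K quot"
  by (intro pmodule_quot pmodule_restrict sub_pmod_restrict pmodule sub_num sub_den den_le_num)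

lemma num_carrier: "m \<in> M\<^sub>1 p \<Longrightarrow> m \<in> carrier (obj M p)"
  using module.submoduleE(1)[OF pmoduleD(1)[OF pmodule]] sub_num
  unfolding sub_pmod_def by blast

lemma zero_in_den: "\<zero>\<^bsub>obj M p\<^esub> \<in> M\<^sub>2 p"
  using sub_den submodule.axioms(1) subgroup.one_closed
  unfolding sub_pmod_def by fastforce

lemma cls_self:
  assumes "m \<in> M\<^sub>1 p" shows "m \<in> cls p m"
proof -
  interpret module K "obj M p" by (rule pmoduleD(1)[OF pmodule])
  show ?thesis
    using zero_in_den[of p] num_carrier[OF assms] unfolding a_r_coset_def' by force
qed

lemma quot_setup_num: "quot_setup K ((obj M p)\<lparr>carrier := M\<^sub>1 p\<rparr>) (M\<^sub>2 p)"
  using pmoduleD(1)[OF pmodule_restrict[OF pmodule sub_num], of p]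
    sub_pmod_restrict[OF pmodule sub_num sub_den den_le_num]
  by (simp add: quot_setup_def quot_setup_axioms_def sub_pmod_def restrict_pmod_def)

lemma cls_num: "M\<^sub>2 p +>\<^bsub>(obj M p)\<lparr>carrier := M\<^sub>1 p\<rparr>\<^esub> m = cls p m"
  by (simp add: a_r_coset_def')

lemma carrier_subquotient: "carrier (obj quot p) = cls p ` M\<^sub>1 p"
  using quot_setup.carrier_quot[OF quot_setup_num]
  by (simp add: quot_pmod_def restrict_pmod_def cls_num)

lemma zero_subquotient: "\<zero>\<^bsub>obj quot p\<^esub> = M\<^sub>2 p"
  by (simp add: quot_pmod_def quot_space_def)

lemma add_subquotient:
  "\<lbrakk>m \<in> M\<^sub>1 p; m' \<in> M\<^sub>1 p\<rbrakk> \<Longrightarrow> cls p m \<oplus>\<^bsub>obj quot p\<^esub> cls p m' = cls p (m \<oplus>\<^bsub>obj M p\<^esub> m')"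
  using quot_setup.quot_add[OF quot_setup_num, of m p m']
  by (simp add: quot_pmod_def restrict_pmod_def cls_num)

lemma smult_subquotient:
  "\<lbrakk>a \<in> carrier K; m \<in> M\<^sub>1 p\<rbrakk> \<Longrightarrow> a \<odot>\<^bsub>obj quot p\<^esub> cls p m = cls p (a \<odot>\<^bsub>obj M p\<^esub> m)"
  using quot_setup.quot_smult[OF quot_setup_num, of a m p]
  by (simp add: quot_pmod_def restrict_pmod_def cls_num)

lemma arr_subquotient: "arr quot p q X = (\<Union>x\<in>X. cls q (arr M p q x))"
  by (simp add: quot_pmod_def restrict_pmod_def cls_num)

lemma submodule_num: "submodule (M\<^sub>1 p) K (obj M p)"
  using sub_num by (simp add: sub_pmod_def)

lemma num_add: "\<lbrakk>m \<in> M\<^sub>1 p; m' \<in> M\<^sub>1 p\<rbrakk> \<Longrightarrow> m \<oplus>\<^bsub>obj M p\<^esub> m' \<in> M\<^sub>1 p"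
  by (rule module.submoduleE(5)[OF pmoduleD(1)[OF pmodule] submodule_num])

lemma num_smult: "\<lbrakk>a \<in> carrier K; m \<in> M\<^sub>1 p\<rbrakk> \<Longrightarrow> a \<odot>\<^bsub>obj M p\<^esub> m \<in> M\<^sub>1 p"
  by (rule module.submoduleE(4)[OF pmoduleD(1)[OF pmodule] submodule_num])

lemma num_arr: "\<lbrakk>p \<le> q; m \<in> M\<^sub>1 p\<rbrakk> \<Longrightarrow> arr M p q m \<in> M\<^sub>1 q"
  using sub_num by (simp add: sub_pmod_def image_subset_iff)

lemma class_num:
  assumes "X \<in> carrier (obj quot p)" "m \<in> X" shows "m \<in> M\<^sub>1 p"
  using assms den_le_num[of p] num_add
  unfolding carrier_subquotient a_r_coset_def' by blast

text \<open>Operations on classes are controlled through arbitrary elements of them. Asserting only membership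
  in the resulting class spares every argument that an operation is well defined.\<close>

lemma class_add:
  assumes "X \<in> carrier (obj quot p)" "m \<in> X" "Y \<in> carrier (obj quot p)" "m' \<in> Y"
  shows "m \<oplus>\<^bsub>obj M p\<^esub> m' \<in> X \<oplus>\<^bsub>obj quot p\<^esub> Y"
  using assms by (auto simp: quot_pmod_def quot_space_def restrict_pmod_def set_add_def')

lemma class_smult:
  assumes "a \<in> carrier K" "X \<in> carrier (obj quot p)" "m \<in> X"
  shows "a \<odot>\<^bsub>obj M p\<^esub> m \<in> a \<odot>\<^bsub>obj quot p\<^esub> X"
  using assms(3) cls_self[OF num_smult[OF assms(1) class_num[OF assms(2,3)]]]
  by (auto simp: quot_pmod_def quot_space_def restrict_pmod_def cls_num)

lemma class_arr:
  assumes "p \<le> q" "X \<in> carrier (obj quot p)" "m \<in> X"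
  shows "arr M p q m \<in> arr quot p q X"
  using assms(3) cls_self[OF num_arr[OF assms(1) class_num[OF assms(2,3)]]]
  by (auto simp: arr_subquotient)

lemma class_nonempty: "X \<in> carrier (obj quot p) \<Longrightarrow> \<exists>m. m \<in> X"
  unfolding carrier_subquotient using cls_self by blast

lemma class_zero:
  assumes "X \<in> carrier (obj quot p)" "\<zero>\<^bsub>obj M p\<^esub> \<in> X"
  shows "X = M\<^sub>2 p"
proof -
  interpret quot_setup K "(obj M p)\<lparr>carrier := M\<^sub>1 p\<rparr>" "M\<^sub>2 p" by (rule quot_setup_num)
  obtain m where m: "m \<in> M\<^sub>1 p" "X = cls p m" using assms(1) carrier_subquotient by blast
  have "M\<^sub>2 p +>\<^bsub>(obj M p)\<lparr>carrier := M\<^sub>1 p\<rparr>\<^esub> \<zero>\<^bsub>obj M p\<^esub> = M\<^sub>2 p +>\<^bsub>(obj M p)\<lparr>carrier := M\<^sub>1 p\<rparr>\<^esub> m"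
    using W.a_repr_independence'[of "\<zero>\<^bsub>obj M p\<^esub>" m] assms(2) m by (simp add: cls_num)
  moreover have "M\<^sub>2 p +>\<^bsub>(obj M p)\<lparr>carrier := M\<^sub>1 p\<rparr>\<^esub> \<zero>\<^bsub>obj M p\<^esub> = M\<^sub>2 p"
    using W.a_rcos_const[OF W.zero_closed] by simp
  ultimately show ?thesis using m by (simp add: cls_num)
qed

end

section \<open>Correspondences\<close>

text \<open>An additive relation from \<open>M\<close> to \<open>N\<close>, that is, a submodule of the direct sum.\<close>

locale correspondence =
  fixes K :: "('k, 'm) ring_scheme" and M :: "('p::order, 'k, 'a) pmod"
    and N :: "('p, 'k, 'b) pmod" and R :: "'p \<Rightarrow> ('a \<times> 'b) set"
  assumes pmodule_left: "pmodule K M" and pmodule_right: "pmodule K N"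
    and left_carrier: "(m, n) \<in> R p \<Longrightarrow> m \<in> carrier (obj M p)"
    and right_carrier: "(m, n) \<in> R p \<Longrightarrow> n \<in> carrier (obj N p)"
    and related_zero: "(\<zero>\<^bsub>obj M p\<^esub>, \<zero>\<^bsub>obj N p\<^esub>) \<in> R p"
    and related_add: "\<lbrakk>(m, n) \<in> R p; (m', n') \<in> R p\<rbrakk>
      \<Longrightarrow> (m \<oplus>\<^bsub>obj M p\<^esub> m', n \<oplus>\<^bsub>obj N p\<^esub> n') \<in> R p"
    and related_smult: "\<lbrakk>a \<in> carrier K; (m, n) \<in> R p\<rbrakk>
      \<Longrightarrow> (a \<odot>\<^bsub>obj M p\<^esub> m, a \<odot>\<^bsub>obj N p\<^esub> n) \<in> R p"
    and related_arr: "\<lbrakk>p \<le> q; (m, n) \<in> R p\<rbrakk> \<Longrightarrow> (arr M p q m, arr N p q n) \<in> R q"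
begin

text \<open>The symmetry in \<open>M\<close> and \<open>N\<close>, by which facts about one side carry over to the other.\<close>

lemma converse: "correspondence K N M (\<lambda>p. (R p)\<inverse>)"
  by unfold_locales
    (auto intro: pmodule_left pmodule_right left_carrier right_carrier related_zero related_add
      related_smult related_arr)

abbreviation num :: "'p \<Rightarrow> 'a set" where
  "num p \<equiv> Domain (R p)"

abbreviation den :: "'p \<Rightarrow> 'a set" where
  "den p \<equiv> {m. (m, \<zero>\<^bsub>obj N p\<^esub>) \<in> R p}"

abbreviation rnum :: "'p \<Rightarrow> 'b set" where
  "rnum p \<equiv> Range (R p)"

abbreviation rden :: "'p \<Rightarrow> 'b set" where
  "rden p \<equiv> {n. (\<zero>\<^bsub>obj M p\<^esub>, n) \<in> R p}"

abbreviation lquot :: "('p, 'k, 'a set) pmod" where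
  "lquot \<equiv> quot_pmod (restrict_pmod M num) den"

abbreviation rquot :: "('p, 'k, 'b set) pmod" where
  "rquot \<equiv> quot_pmod (restrict_pmod N rnum) rden"

lemma related_uminus:
  assumes "(m, n) \<in> R p"
  shows "(\<ominus>\<^bsub>obj M p\<^esub> m, \<ominus>\<^bsub>obj N p\<^esub> n) \<in> R p"
proof -
  interpret M: module K "obj M p" by (rule pmoduleD(1)[OF pmodule_left])
  interpret N: module K "obj N p" by (rule pmoduleD(1)[OF pmodule_right])
  have "(\<ominus>\<^bsub>K\<^esub> \<one>\<^bsub>K\<^esub> \<odot>\<^bsub>obj M p\<^esub> m, \<ominus>\<^bsub>K\<^esub> \<one>\<^bsub>K\<^esub> \<odot>\<^bsub>obj N p\<^esub> n) \<in> R p"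
    using related_smult[OF _ assms] by simp
  then show ?thesis
    using left_carrier[OF assms] right_carrier[OF assms]
    by (simp add: M.smult_l_minus N.smult_l_minus)
qed

lemma submodule_num: "submodule (num p) K (obj M p)"
  and submodule_den: "submodule (den p) K (obj M p)"
proof -
  interpret M: module K "obj M p" by (rule pmoduleD(1)[OF pmodule_left])
  interpret N: module K "obj N p" by (rule pmoduleD(1)[OF pmodule_right])
  show "submodule (num p) K (obj M p)"
    by (rule M.submoduleI)
      (use left_carrier related_zero related_uminus related_add related_smult in blast)+
  have "(\<ominus>\<^bsub>obj M p\<^esub> m, \<zero>\<^bsub>obj N p\<^esub>) \<in> R p" if "(m, \<zero>\<^bsub>obj N p\<^esub>) \<in> R p" for m
    using related_uminus[OF that] by (metis N.M.l_neg N.M.r_zero N.M.zero_closed N.M.a_inv_closed)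
  moreover have "(m \<oplus>\<^bsub>obj M p\<^esub> m', \<zero>\<^bsub>obj N p\<^esub>) \<in> R p"
    if "(m, \<zero>\<^bsub>obj N p\<^esub>) \<in> R p" "(m', \<zero>\<^bsub>obj N p\<^esub>) \<in> R p" for m m'
    using related_add[OF that] by simp
  moreover have "(a \<odot>\<^bsub>obj M p\<^esub> m, \<zero>\<^bsub>obj N p\<^esub>) \<in> R p"
    if "a \<in> carrier K" "(m, \<zero>\<^bsub>obj N p\<^esub>) \<in> R p" for a m
    using related_smult[OF that] that(1) by simp
  ultimately show "submodule (den p) K (obj M p)"
    by (intro M.submoduleI) (use left_carrier related_zero in auto)
qed

lemma sub_pmod_num: "sub_pmod K M num"
  using submodule_num related_arr unfolding sub_pmod_def by blast

lemma sub_pmod_den: "sub_pmod K M den"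
  using submodule_den related_arr arr_zero[OF pmodule_right]
  unfolding sub_pmod_def by fastforce

lemma subquotient_left: "subquotient K M num den"
  by unfold_locales (use pmodule_left sub_pmod_num sub_pmod_den in blast)+

lemma related_diff:
  assumes "(m, n) \<in> R p" "(m', n') \<in> R p"
  shows "(m \<ominus>\<^bsub>obj M p\<^esub> m', n \<ominus>\<^bsub>obj N p\<^esub> n') \<in> R p"
  using related_add[OF assms(1) related_uminus[OF assms(2)]] by (simp add: a_minus_def)

text \<open>The indeterminacy of the values of \<open>R\<close> is a coset of its values at zero: two elements related
  to the same \<open>m\<close> differ by an element related to zero. Hence taking images under \<open>R\<close> sends classes to classes.\<close>

lemma image_class:
  assumes R: "(m, n) \<in> R p"
  shows "R p `` (den p +>\<^bsub>obj M p\<^esub> m) = rden p +>\<^bsub>obj N p\<^esub> n"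
    (is "?L = ?C")
proof -
  interpret M: module K "obj M p" by (rule pmoduleD(1)[OF pmodule_left])
  interpret N: module K "obj N p" by (rule pmoduleD(1)[OF pmodule_right])
  show ?thesis
  proof (intro equalityI subsetI)
    fix n' assume "n' \<in> ?L"
    then obtain h where h: "(h, \<zero>\<^bsub>obj N p\<^esub>) \<in> R p" and n': "(h \<oplus>\<^bsub>obj M p\<^esub> m, n') \<in> R p"
      by (auto simp: a_r_coset_def')
    have n'_carrier: "n' \<in> carrier (obj N p)" using right_carrier[OF n'] .
    have "(h \<oplus>\<^bsub>obj M p\<^esub> m, n) \<in> R p"
      using related_add[OF h R] right_carrier[OF R] by simp
    then have "(\<zero>\<^bsub>obj M p\<^esub>, n' \<ominus>\<^bsub>obj N p\<^esub> n) \<in> R p"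
      using related_diff[OF n'] left_carrier[OF n'] by (metis M.M.r_neg a_minus_def)
    moreover have "n' = (n' \<ominus>\<^bsub>obj N p\<^esub> n) \<oplus>\<^bsub>obj N p\<^esub> n"
      using n'_carrier right_carrier[OF R] by (simp add: N.M.minus_eq N.M.a_assoc N.M.l_neg)
    ultimately show "n' \<in> ?C" by (auto simp: a_r_coset_def')
  next
    fix n' assume "n' \<in> ?C"
    then obtain h where h: "(\<zero>\<^bsub>obj M p\<^esub>, h) \<in> R p" and n': "n' = h \<oplus>\<^bsub>obj N p\<^esub> n"
      by (auto simp: a_r_coset_def')
    have "(m, n') \<in> R p" using related_add[OF h R] left_carrier[OF R] n' by simp
    moreover have "m \<in> den p +>\<^bsub>obj M p\<^esub> m"
      using subquotient.cls_self[OF subquotient_left] R by blast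
    ultimately show "n' \<in> ?L" by blast
  qed
qed

lemma converse_image_class:
  "(m, n) \<in> R p \<Longrightarrow> (R p)\<inverse> `` (rden p +>\<^bsub>obj N p\<^esub> n) = den p +>\<^bsub>obj M p\<^esub> m"
  using correspondence.image_class[OF converse, of n m p] by simp

lemma related_class_left:
  assumes "(m, n) \<in> R p" "x \<in> den p +>\<^bsub>obj M p\<^esub> m"
  shows "(x, n) \<in> R p"
proof -
  interpret N: module K "obj N p" by (rule pmoduleD(1)[OF pmodule_right])
  obtain h where "(h, \<zero>\<^bsub>obj N p\<^esub>) \<in> R p" "x = h \<oplus>\<^bsub>obj M p\<^esub> m"
    using assms(2) by (auto simp: a_r_coset_def')
  then show ?thesis
    using related_add[OF _ assms(1)] right_carrier[OF assms(1)] by fastforce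
qed

lemma related_class_right:
  "\<lbrakk>(m, n) \<in> R p; y \<in> rden p +>\<^bsub>obj N p\<^esub> n\<rbrakk> \<Longrightarrow> (m, y) \<in> R p"
  using correspondence.related_class_left[OF converse, of n m p y] by simp

lemma subquotient_right: "subquotient K N rnum rden"
  using correspondence.subquotient_left[OF converse] by simp

lemma image_morphism: "morphism K lquot rquot (\<lambda>p X. R p `` X)"
proof -
  interpret L: subquotient K M num den by (rule subquotient_left)
  interpret Q: subquotient K N rnum rden by (rule subquotient_right)
  have ex: "\<exists>m n. (m, n) \<in> R p \<and> X = L.cls p m \<and> R p `` X = Q.cls p n"
    if "X \<in> carrier (obj lquot p)" for p X
    using that image_class unfolding L.carrier_subquotient by blast
  have "(\<lambda>X. R p `` X) \<in> linear_maps K (obj lquot p) (obj rquot p)" for p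
  proof (rule linear_mapsI)
    fix X assume "X \<in> carrier (obj lquot p)"
    then show "R p `` X \<in> carrier (obj rquot p)"
      using ex unfolding Q.carrier_subquotient by blast
  next
    fix X Y assume "X \<in> carrier (obj lquot p)" "Y \<in> carrier (obj lquot p)"
    then obtain m n m' n' where X: "(m, n) \<in> R p" "X = L.cls p m"
      and Y: "(m', n') \<in> R p" "Y = L.cls p m'"
      using ex by meson
    then show "R p `` (X \<oplus>\<^bsub>obj lquot p\<^esub> Y) = R p `` X \<oplus>\<^bsub>obj rquot p\<^esub> R p `` Y"
      using L.add_subquotient[of m p m'] Q.add_subquotient[of n p n']
        image_class[OF X(1)] image_class[OF Y(1)] image_class[OF related_add[OF X(1) Y(1)]]
      by (simp add: DomainI RangeI)
  next
    fix a X assume a: "a \<in> carrier K" and "X \<in> carrier (obj lquot p)"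
    then obtain m n where X: "(m, n) \<in> R p" "X = L.cls p m"
      using ex by meson
    then show "R p `` (a \<odot>\<^bsub>obj lquot p\<^esub> X) = a \<odot>\<^bsub>obj rquot p\<^esub> R p `` X"
      using L.smult_subquotient[OF a, of m p] Q.smult_subquotient[OF a, of n p]
        image_class[OF X(1)] image_class[OF related_smult[OF a X(1)]]
      by (simp add: DomainI RangeI)
  qed
  moreover have "R q `` arr lquot p q X = arr rquot p q (R p `` X)"
    if pq: "p \<le> q" and "X \<in> carrier (obj lquot p)" for p q X
  proof -
    obtain m n where X: "(m, n) \<in> R p" "X = L.cls p m" "R p `` X = Q.cls p n"
      using ex \<open>X \<in> carrier (obj lquot p)\<close> by meson
    have n: "n \<in> Q.cls p n" and m: "m \<in> X"
      using Q.cls_self L.cls_self X by blast+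
    \<comment> \<open>Every representative of \<open>X\<close> is related to \<open>n\<close>, and \<open>m\<close> to every element of the
      image of \<open>X\<close>; hence all the cosets in either union coincide.\<close>
    have "R q `` L.cls q (arr M p q x) = Q.cls q (arr N p q n)" if "x \<in> X" for x
    proof -
      have "(x, n) \<in> R p"
        using related_class_left[OF X(1)] that X(2) by blast
      then show ?thesis using image_class related_arr[OF pq] by blast
    qed
    then have "R q `` arr lquot p q X = Q.cls q (arr N p q n)"
      using m unfolding L.arr_subquotient by blast
    moreover have "Q.cls q (arr N p q y) = Q.cls q (arr N p q n)" if "y \<in> Q.cls p n" for y
    proof -
      have "(m, y) \<in> R p"
        using related_class_right[OF X(1) that] .
      then show ?thesis using image_class[OF related_arr[OF pq]] X(1) by blast
    qed
    then have "arr rquot p q (R p `` X) = Q.cls q (arr N p q n)"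
      using n unfolding Q.arr_subquotient X(3) by blast
    ultimately show ?thesis by simp
  qed
  ultimately show ?thesis by (simp add: morphism_def)
qed

text \<open>Goursat's lemma. The isomorphism and its inverse are the images under \<open>R\<close> and under its
  converse, so they do not depend on choices of representatives.\<close>

theorem quotients_isomorphic: "isomorphic_pmod K lquot rquot"
proof -
  interpret L: subquotient K M num den by (rule subquotient_left)
  interpret Q: subquotient K N rnum rden by (rule subquotient_right)
  interpret C: correspondence K N M "\<lambda>p. (R p)\<inverse>" by (rule converse)
  have "(R p)\<inverse> `` (R p `` X) = X" if X: "X \<in> carrier (obj lquot p)" for p X
  proof -
    obtain m n where "(m, n) \<in> R p" "X = L.cls p m"
      using X unfolding L.carrier_subquotient by blast
    then show ?thesis by (simp add: image_class converse_image_class)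
  qed
  moreover have "R p `` ((R p)\<inverse> `` Y) = Y" if Y: "Y \<in> carrier (obj rquot p)" for p Y
  proof -
    obtain m n where "(m, n) \<in> R p" "Y = Q.cls p n"
      using Y unfolding Q.carrier_subquotient by blast
    then show ?thesis by (simp add: image_class converse_image_class)
  qed
  ultimately have "mor_eq lquot (mor_comp (\<lambda>p Y. (R p)\<inverse> `` Y) (\<lambda>p X. R p `` X)) mor_id"
    "mor_eq rquot (mor_comp (\<lambda>p X. R p `` X) (\<lambda>p Y. (R p)\<inverse> `` Y)) mor_id"
    by (simp_all add: mor_eq_def mor_comp_def mor_id_def)
  moreover have "morphism K rquot lquot (\<lambda>p Y. (R p)\<inverse> `` Y)"
    using C.image_morphism by simp
  ultimately show ?thesis
    using image_morphism unfolding isomorphic_pmod_def by blast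
qed

end

section \<open>Correspondences bounded by images and kernels\<close>

text \<open>The chosen \<open>n\<close> is determined only up to elements related to zero. If the map \<open>N(\<epsilon>) \<rightarrow> N(\<epsilon> + \<delta>)\<close>
  annihilates these, the value does not depend on the choice.\<close>

definition transport ::
    "(real \<Rightarrow> 'p \<Rightarrow> 'p) \<Rightarrow> real \<Rightarrow> real \<Rightarrow> ('p, 'k, 'a) pmod \<Rightarrow> ('p, 'k, 'b) pmod
      \<Rightarrow> ('p \<Rightarrow> ('a \<times> 'b) set) \<Rightarrow> 'p \<Rightarrow> 'a \<Rightarrow> 'b" where
  "transport S \<epsilon> \<delta> M N R p m =
     arr N (S \<epsilon> p) (S (\<epsilon> + \<delta>) p) (SOME n. (arr M p (S \<epsilon> p) m, n) \<in> R (S \<epsilon> p))"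

text \<open>The bounds say how far \<open>R\<close> is from being an isomorphism: up to a shift it is defined everywhere and
  onto, and up to a shift it is single-valued and injective.\<close>

locale erosion_correspondence = correspondence K M N R + poset_flow S
  for K :: "('k, 'm) ring_scheme" and M :: "('p::order, 'k, 'a) pmod"
    and N :: "('p, 'k, 'b) pmod" and R and S :: "real \<Rightarrow> 'p \<Rightarrow> 'p" +
  fixes \<epsilon> \<delta> :: real
  assumes nonneg_left: "0 \<le> \<epsilon>" and nonneg_right: "0 \<le> \<delta>"
    and Im_left: "Im_sub S \<epsilon> M p \<subseteq> Domain (R p)"
    and Im_right: "Im_sub S \<delta> N p \<subseteq> Range (R p)"
    and Ker_left: "(m, \<zero>\<^bsub>obj N p\<^esub>) \<in> R p \<Longrightarrow> m \<in> Ker_sub S \<epsilon> M p"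
    and Ker_right: "(\<zero>\<^bsub>obj M p\<^esub>, n) \<in> R p \<Longrightarrow> n \<in> Ker_sub S \<delta> N p"
begin

lemma erosion_converse: "erosion_correspondence K N M (\<lambda>p. (R p)\<inverse>) S \<delta> \<epsilon>"
  using converse poset_flow_axioms nonneg_left nonneg_right Im_left Im_right Ker_left Ker_right
  by (simp add: erosion_correspondence_def erosion_correspondence_axioms_def)

lemma common_erosion: "lquot \<in> EN K S \<epsilon> M" "lquot \<in> EN K S \<delta> N"
proof -
  interpret L: subquotient K M num den by (rule subquotient_left)
  interpret Q: subquotient K N rnum rden by (rule subquotient_right)
  have EN_left: "lquot \<in> EN K S \<epsilon> M"
    unfolding EN_def mem_Collect_eq
    using L.pmodule_subquotient L.sub_num L.sub_den L.den_le_num Im_left Ker_left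
      isomorphic_pmod_refl[OF L.pmodule_subquotient]
    by (intro conjI exI[of _ num] exI[of _ den]) auto
  show "lquot \<in> EN K S \<epsilon> M" by (fact EN_left)
  show "lquot \<in> EN K S \<delta> N"
    unfolding EN_def mem_Collect_eq
    using L.pmodule_subquotient Q.sub_num Q.sub_den Q.den_le_num Im_right Ker_right
      quotients_isomorphic
    by (intro conjI exI[of _ rnum] exI[of _ rden]) auto
qed

lemma sum_flow: "S \<delta> (S \<epsilon> p) = S (\<epsilon> + \<delta>) p"
  by (simp add: flow_flow add.commute)

text \<open>After a shift by \<open>\<epsilon>\<close>, every element lies in the domain of the correspondence, because it is in the
  image of its own shift.\<close>

lemma ex_related:
  assumes "m \<in> carrier (obj M p)"
  shows "\<exists>n. (arr M p (S \<epsilon> p) m, n) \<in> R (S \<epsilon> p)"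
proof -
  have "arr M p (S \<epsilon> p) m \<in> Im_sub S \<epsilon> M (S \<epsilon> p)"
    using assms by (auto simp: Im_sub_iff flow_flow flow_zero_apply)
  then show ?thesis using Im_left by blast
qed

text \<open>The difference of two elements related to the same \<open>m\<close> is related to zero, hence annihilated by a
  shift by \<open>\<delta>\<close>.\<close>

lemma arr_related_unique:
  assumes "(m, n) \<in> R p" "(m, n') \<in> R p"
  shows "arr N p (S \<delta> p) n = arr N p (S \<delta> p) n'"
proof -
  interpret M: module K "obj M p" by (rule pmoduleD(1)[OF pmodule_left])
  interpret N: module K "obj N p" by (rule pmoduleD(1)[OF pmodule_right])
  interpret N': module K "obj N (S \<delta> p)" by (rule pmoduleD(1)[OF pmodule_right])
  let ?f = "arr N p (S \<delta> p)"
  note lin = linear_mapsD[OF pmoduleD(2)[OF pmodule_right flow_ge[OF nonneg_right, of p]]]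
  note carrier = right_carrier[OF assms(1)] right_carrier[OF assms(2)]
  have "(\<zero>\<^bsub>obj M p\<^esub>, n \<ominus>\<^bsub>obj N p\<^esub> n') \<in> R p"
    using related_diff[OF assms] left_carrier[OF assms(1)] by (metis M.M.r_neg a_minus_def)
  then have "?f (n \<ominus>\<^bsub>obj N p\<^esub> n') = \<zero>\<^bsub>obj N (S \<delta> p)\<^esub>"
    using Ker_right by (simp add: Ker_sub_iff)
  moreover have "n = (n \<ominus>\<^bsub>obj N p\<^esub> n') \<oplus>\<^bsub>obj N p\<^esub> n'"
    using carrier by (simp add: N.M.minus_eq N.M.a_assoc N.M.l_neg)
  then have "?f n = ?f (n \<ominus>\<^bsub>obj N p\<^esub> n') \<oplus>\<^bsub>obj N (S \<delta> p)\<^esub> ?f n'"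
    using lin(2) carrier by (metis N.M.minus_closed)
  ultimately show ?thesis using lin(1) carrier by simp
qed

text \<open>Every \<open>n\<close> may serve as the chosen one. All properties of \<open>transport\<close> follow by exhibiting a
  suitable related element.\<close>

lemma transport_eq:
  assumes "(arr M p (S \<epsilon> p) m, n) \<in> R (S \<epsilon> p)"
  shows "transport S \<epsilon> \<delta> M N R p m = arr N (S \<epsilon> p) (S (\<epsilon> + \<delta>) p) n"
  unfolding transport_def
  using arr_related_unique[OF someI[of "\<lambda>n. (arr M p (S \<epsilon> p) m, n) \<in> R (S \<epsilon> p)", OF assms] assms]
  by (simp add: sum_flow)

lemma transport_morphism: "morphism K M (shift S (\<epsilon> + \<delta>) N) (transport S \<epsilon> \<delta> M N R)"
proof -
  let ?t = "transport S \<epsilon> \<delta> M N R"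
  have le: "p \<le> S \<epsilon> p" "S \<epsilon> p \<le> S (\<epsilon> + \<delta>) p" for p
    using flow_ge[OF nonneg_left] flow_le[of \<epsilon> "\<epsilon> + \<delta>"] nonneg_right by auto
  note linM = linear_mapsD[OF pmoduleD(2)[OF pmodule_left le(1)]]
  note linN = linear_mapsD[OF pmoduleD(2)[OF pmodule_right le(2)]]
  have "?t p \<in> linear_maps K (obj M p) (obj N (S (\<epsilon> + \<delta>) p))" for p
  proof (rule linear_mapsI)
    fix m assume m: "m \<in> carrier (obj M p)"
    obtain n where n: "(arr M p (S \<epsilon> p) m, n) \<in> R (S \<epsilon> p)" using ex_related[OF m] by blast
    show "?t p m \<in> carrier (obj N (S (\<epsilon> + \<delta>) p))"
      using linN(1) right_carrier[OF n] by (simp add: transport_eq[OF n])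
    fix m' assume m': "m' \<in> carrier (obj M p)"
    obtain n' where n': "(arr M p (S \<epsilon> p) m', n') \<in> R (S \<epsilon> p)"
      using ex_related[OF m'] by blast
    have "(arr M p (S \<epsilon> p) (m \<oplus>\<^bsub>obj M p\<^esub> m'), n \<oplus>\<^bsub>obj N (S \<epsilon> p)\<^esub> n') \<in> R (S \<epsilon> p)"
      using related_add[OF n n'] by (simp add: linM(2)[OF m m'])
    from transport_eq[OF this]
    show "?t p (m \<oplus>\<^bsub>obj M p\<^esub> m') = ?t p m \<oplus>\<^bsub>obj N (S (\<epsilon> + \<delta>) p)\<^esub> ?t p m'"
      by (simp add: transport_eq[OF n] transport_eq[OF n']
          linN(2)[OF right_carrier[OF n] right_carrier[OF n']])
  next
    fix a m assume a: "a \<in> carrier K" and m: "m \<in> carrier (obj M p)"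
    obtain n where n: "(arr M p (S \<epsilon> p) m, n) \<in> R (S \<epsilon> p)" using ex_related[OF m] by blast
    have "(arr M p (S \<epsilon> p) (a \<odot>\<^bsub>obj M p\<^esub> m), a \<odot>\<^bsub>obj N (S \<epsilon> p)\<^esub> n) \<in> R (S \<epsilon> p)"
      using related_smult[OF a n] by (simp add: linM(3)[OF a m])
    from transport_eq[OF this]
    show "?t p (a \<odot>\<^bsub>obj M p\<^esub> m) = a \<odot>\<^bsub>obj N (S (\<epsilon> + \<delta>) p)\<^esub> ?t p m"
      by (simp add: transport_eq[OF n] linN(3)[OF a right_carrier[OF n]])
  qed
  moreover have "?t q (arr M p q m) = arr N (S (\<epsilon> + \<delta>) p) (S (\<epsilon> + \<delta>) q) (?t p m)"
    if pq: "p \<le> q" and m: "m \<in> carrier (obj M p)" for p q m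
  proof -
    obtain n where n: "(arr M p (S \<epsilon> p) m, n) \<in> R (S \<epsilon> p)" using ex_related[OF m] by blast
    have "(arr M q (S \<epsilon> q) (arr M p q m), arr N (S \<epsilon> p) (S \<epsilon> q) n) \<in> R (S \<epsilon> q)"
      using related_arr[OF flow_mono[OF pq] n]
      by (simp add: pmoduleD(4)[OF pmodule_left _ _ m] le pq flow_mono)
    from transport_eq[OF this] show ?thesis
      by (simp add: transport_eq[OF n] pmoduleD(4)[OF pmodule_right _ _ right_carrier[OF n]]
          le pq flow_mono)
  qed
  ultimately show ?thesis by (simp add: morphism_def shift_def)
qed

text \<open>If \<open>n\<close> is related to the shift of \<open>m\<close> by \<open>\<epsilon>\<close>, then the shift of \<open>n\<close> by a further \<open>2 * \<delta>\<close>
  is related to that of \<open>m\<close> by \<open>\<epsilon> + 2 * \<delta>\<close>. So the latter may be chosen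
  when going back, and a last shift by \<open>\<epsilon>\<close> remains.\<close>

lemma transport_transport:
  assumes m: "m \<in> carrier (obj M p)"
  shows "transport S \<delta> \<epsilon> N M (\<lambda>p. (R p)\<inverse>) (S (\<epsilon> + \<delta>) p) (transport S \<epsilon> \<delta> M N R p m)
    = arr M p (S (2 * (\<epsilon> + \<delta>)) p) m"
proof -
  interpret C: erosion_correspondence K N M "\<lambda>p. (R p)\<inverse>" S \<delta> \<epsilon> by (rule erosion_converse)
  let ?q = "S (\<epsilon> + \<delta>) p" and ?r = "S (2 * (\<epsilon> + \<delta>)) p"
  have q: "S \<delta> ?q = S (\<epsilon> + 2 * \<delta>) p" "S (\<delta> + \<epsilon>) ?q = ?r"
    by (simp_all add: flow_flow algebra_simps)
  have le: "p \<le> S \<epsilon> p" "S \<epsilon> p \<le> ?q" "?q \<le> S (\<epsilon> + 2 * \<delta>) p" "S (\<epsilon> + 2 * \<delta>) p \<le> ?r"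
    using flow_ge nonneg_left nonneg_right by (auto intro!: flow_le)
  note lt = order_trans[OF le(2,3)]
  obtain n where n: "(arr M p (S \<epsilon> p) m, n) \<in> R (S \<epsilon> p)" using ex_related[OF m] by blast
  have "(arr M p (S (\<epsilon> + 2 * \<delta>) p) m, arr N (S \<epsilon> p) (S (\<epsilon> + 2 * \<delta>) p) n)
      \<in> R (S (\<epsilon> + 2 * \<delta>) p)"
    using related_arr[OF lt n] by (simp add: pmoduleD(4)[OF pmodule_left le(1) lt m])
  then have "(arr N ?q (S \<delta> ?q) (transport S \<epsilon> \<delta> M N R p m), arr M p (S (\<epsilon> + 2 * \<delta>) p) m)
      \<in> (R (S \<delta> ?q))\<inverse>"
    by (simp add: q transport_eq[OF n] pmoduleD(4)[OF pmodule_right le(2,3) right_carrier[OF n]])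
  from C.transport_eq[OF this] show ?thesis
    unfolding q pmoduleD(4)[OF pmodule_left order_trans[OF le(1) lt] le(4) m] .
qed

theorem interleaved_sum: "interleaved K S (\<epsilon> + \<delta>) M N"
proof -
  interpret C: erosion_correspondence K N M "\<lambda>p. (R p)\<inverse>" S \<delta> \<epsilon> by (rule erosion_converse)
  show ?thesis
    unfolding interleaved_def
    using transport_morphism C.transport_morphism transport_transport C.transport_transport
      nonneg_left nonneg_right
    by (intro conjI exI[of _ "transport S \<epsilon> \<delta> M N R"]
        exI[of _ "transport S \<delta> \<epsilon> N M (\<lambda>p. (R p)\<inverse>)"])
      (simp_all add: add.commute[of \<delta>] mor_eq_def mor_comp_def shift_mor_def transition_def
        flow_zero_apply)
qed

end

section \<open>Correspondences from interleavings and from common subquotients\<close>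

text \<open>The relation is the kernel of
  \<open>(m, n) \<mapsto> (M\<^bsub>0\<rightarrow>\<epsilon>\<^esub> m - \<psi> n, N\<^bsub>0\<rightarrow>\<epsilon>\<^esub> n - \<phi> m)\<close>. Its domain contains the image of each \<open>x\<close> in \<open>M(-\<epsilon>)\<close>, as
  the interleaving identity for \<open>\<psi>\<close> after \<open>\<phi>\<close> and naturality of \<open>\<phi>\<close> make that image related to
  \<open>\<phi> x\<close>.\<close>

lemma (in poset_flow) interleaved_imp_erosion_correspondence:
  assumes M: "pmodule K M" and N: "pmodule K N" and "interleaved K S \<epsilon> M N"
  shows "\<exists>R. erosion_correspondence K M N R S \<epsilon> \<epsilon>"
proof -
  obtain \<phi> \<psi> where nonneg: "0 \<le> \<epsilon>"
    and \<phi>: "morphism K M (shift S \<epsilon> N) \<phi>" and \<psi>: "morphism K N (shift S \<epsilon> M) \<psi>"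
    and "mor_eq M (mor_comp (shift_mor S \<epsilon> \<psi>) \<phi>) (transition S M 0 (2 * \<epsilon>))"
    and "mor_eq N (mor_comp (shift_mor S \<epsilon> \<phi>) \<psi>) (transition S N 0 (2 * \<epsilon>))"
    using assms(3) unfolding interleaved_def by blast
  then have "\<forall>p. \<forall>m\<in>carrier (obj M p). \<psi> (S \<epsilon> p) (\<phi> p m) = arr M p (S (2 * \<epsilon>) p) m"
    and "\<forall>p. \<forall>n\<in>carrier (obj N p). \<phi> (S \<epsilon> p) (\<psi> p n) = arr N p (S (2 * \<epsilon>) p) n"
    by (auto simp: mor_eq_def mor_comp_def shift_mor_def transition_def flow_zero_apply)
  note \<psi>_\<phi> = this(1)[rule_format] and \<phi>_\<psi> = this(2)[rule_format]
  have le: "p \<le> S \<epsilon> p" for p by (rule flow_ge[OF nonneg])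
  define R where "R p = {(m, n). m \<in> carrier (obj M p) \<and> n \<in> carrier (obj N p)
    \<and> arr M p (S \<epsilon> p) m = \<psi> p n \<and> arr N p (S \<epsilon> p) n = \<phi> p m}" for p
  note \<phi>_lin = linear_mapsD[OF morphismD(1)[OF \<phi>], unfolded shift_def pmod.simps]
    and \<psi>_lin = linear_mapsD[OF morphismD(1)[OF \<psi>], unfolded shift_def pmod.simps]
  note M_lin = linear_mapsD[OF pmoduleD(2)[OF M]] and N_lin = linear_mapsD[OF pmoduleD(2)[OF N]]
  have \<phi>_nat: "\<phi> q (arr M p q m) = arr N (S \<epsilon> p) (S \<epsilon> q) (\<phi> p m)"
    if "p \<le> q" "m \<in> carrier (obj M p)" for p q m
    using morphismD(3)[OF \<phi> that] by (simp add: shift_def)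
  have \<psi>_nat: "\<psi> q (arr N p q n) = arr M (S \<epsilon> p) (S \<epsilon> q) (\<psi> p n)"
    if "p \<le> q" "n \<in> carrier (obj N p)" for p q n
    using morphismD(3)[OF \<psi> that] by (simp add: shift_def)
  have \<phi>_zero: "\<phi> p \<zero>\<^bsub>obj M p\<^esub> = \<zero>\<^bsub>obj N (S \<epsilon> p)\<^esub>" for p
    using linear_maps_zero[OF pmoduleD(1)[OF M] pmoduleD(1)[OF N]] morphismD(1)[OF \<phi>]
    by (simp add: shift_def)
  have \<psi>_zero: "\<psi> p \<zero>\<^bsub>obj N p\<^esub> = \<zero>\<^bsub>obj M (S \<epsilon> p)\<^esub>" for p
    using linear_maps_zero[OF pmoduleD(1)[OF N] pmoduleD(1)[OF M]] morphismD(1)[OF \<psi>]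
    by (simp add: shift_def)
  have R: "correspondence K M N R"
  proof unfold_locales
    fix p q m n m' n' a
    interpret M: module K "obj M p" by (rule pmoduleD(1)[OF M])
    interpret N: module K "obj N p" by (rule pmoduleD(1)[OF N])
    show "pmodule K M" by (fact M)
    show "pmodule K N" by (fact N)
    show "(\<zero>\<^bsub>obj M p\<^esub>, \<zero>\<^bsub>obj N p\<^esub>) \<in> R p"
      by (simp add: R_def \<phi>_zero \<psi>_zero arr_zero[OF M le] arr_zero[OF N le])
    { assume "(m, n) \<in> R p"
      then show "m \<in> carrier (obj M p)" "n \<in> carrier (obj N p)" by (simp_all add: R_def) }
    { assume "(m, n) \<in> R p" "(m', n') \<in> R p"
      then show "(m \<oplus>\<^bsub>obj M p\<^esub> m', n \<oplus>\<^bsub>obj N p\<^esub> n') \<in> R p"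
        by (simp add: R_def \<phi>_lin \<psi>_lin M_lin[OF le] N_lin[OF le]) }
    { assume "a \<in> carrier K" "(m, n) \<in> R p"
      then show "(a \<odot>\<^bsub>obj M p\<^esub> m, a \<odot>\<^bsub>obj N p\<^esub> n) \<in> R p"
        by (simp add: R_def \<phi>_lin \<psi>_lin M_lin[OF le] N_lin[OF le]) }
    { assume pq: "p \<le> q" and "(m, n) \<in> R p"
      then have mn: "m \<in> carrier (obj M p)" "n \<in> carrier (obj N p)"
        "arr M p (S \<epsilon> p) m = \<psi> p n" "arr N p (S \<epsilon> p) n = \<phi> p m"
        by (simp_all add: R_def)
      have "arr M q (S \<epsilon> q) (arr M p q m) = arr M (S \<epsilon> p) (S \<epsilon> q) (arr M p (S \<epsilon> p) m)"
        "arr N q (S \<epsilon> q) (arr N p q n) = arr N (S \<epsilon> p) (S \<epsilon> q) (arr N p (S \<epsilon> p) n)"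
        by (simp_all add: pmoduleD(4)[OF M le flow_mono[OF pq] mn(1)] pmoduleD(4)[OF M pq le mn(1)]
            pmoduleD(4)[OF N le flow_mono[OF pq] mn(2)] pmoduleD(4)[OF N pq le mn(2)])
      then show "(arr M p q m, arr N p q n) \<in> R q"
        using mn pq by (simp add: R_def \<phi>_nat \<psi>_nat M_lin(1) N_lin(1)) }
  qed
  have shift_back: "S \<epsilon> (S (- \<epsilon>) p) = p" "S (2 * \<epsilon>) (S (- \<epsilon>) p) = S \<epsilon> p" "S (- \<epsilon>) p \<le> p" for p
    using flow_le[of "- \<epsilon>" 0 p] nonneg by (simp_all add: flow_flow flow_zero_apply)
  have "Im_sub S \<epsilon> M p \<subseteq> Domain (R p)" for p
  proof
    fix m assume "m \<in> Im_sub S \<epsilon> M p"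
    then obtain x where x: "x \<in> carrier (obj M (S (- \<epsilon>) p))" "m = arr M (S (- \<epsilon>) p) p x"
      by (auto simp: Im_sub_iff)
    have "(m, \<phi> (S (- \<epsilon>) p) x) \<in> R p"
      using x \<psi>_\<phi>[OF x(1)] \<phi>_nat[OF shift_back(3) x(1)] M_lin(1)[OF shift_back(3) x(1)]
        \<phi>_lin(1)[OF x(1)] pmoduleD(4)[OF M shift_back(3) le x(1)]
      by (simp add: R_def shift_back)
    then show "m \<in> Domain (R p)" by blast
  qed
  moreover have "Im_sub S \<epsilon> N p \<subseteq> Range (R p)" for p
  proof
    fix n assume "n \<in> Im_sub S \<epsilon> N p"
    then obtain y where y: "y \<in> carrier (obj N (S (- \<epsilon>) p))" "n = arr N (S (- \<epsilon>) p) p y"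
      by (auto simp: Im_sub_iff)
    have "(\<psi> (S (- \<epsilon>) p) y, n) \<in> R p"
      using y \<phi>_\<psi>[OF y(1)] \<psi>_nat[OF shift_back(3) y(1)] N_lin(1)[OF shift_back(3) y(1)]
        \<psi>_lin(1)[OF y(1)] pmoduleD(4)[OF N shift_back(3) le y(1)]
      by (simp add: R_def shift_back)
    then show "n \<in> Range (R p)" by blast
  qed
  moreover have "m \<in> Ker_sub S \<epsilon> M p" if "(m, \<zero>\<^bsub>obj N p\<^esub>) \<in> R p" for m p
    using that by (simp add: R_def Ker_sub_iff \<psi>_zero)
  moreover have "n \<in> Ker_sub S \<epsilon> N p" if "(\<zero>\<^bsub>obj M p\<^esub>, n) \<in> R p" for n p
    using that by (simp add: R_def Ker_sub_iff \<phi>_zero)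
  ultimately have "erosion_correspondence K M N R S \<epsilon> \<epsilon>"
    using R nonneg poset_flow_axioms
    by (simp add: erosion_correspondence_def erosion_correspondence_axioms_def)
  then show ?thesis by blast
qed

lemma EN_D:
  assumes "pmodule K M" "Q \<in> EN K S \<epsilon> M"
  obtains M\<^sub>1 M\<^sub>2 f g where "subquotient K M M\<^sub>1 M\<^sub>2"
    "\<And>p. Im_sub S \<epsilon> M p \<subseteq> M\<^sub>1 p" "\<And>p. M\<^sub>2 p \<subseteq> Ker_sub S \<epsilon> M p"
    "morphism K Q (quot_pmod (restrict_pmod M M\<^sub>1) M\<^sub>2) f"
    "morphism K (quot_pmod (restrict_pmod M M\<^sub>1) M\<^sub>2) Q g"
    "\<And>p x. x \<in> carrier (obj Q p) \<Longrightarrow> g p (f p x) = x"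
    "\<And>p X. X \<in> carrier (obj (quot_pmod (restrict_pmod M M\<^sub>1) M\<^sub>2) p) \<Longrightarrow> f p (g p X) = X"
proof -
  obtain M\<^sub>1 M\<^sub>2 where sub: "sub_pmod K M M\<^sub>1" "sub_pmod K M M\<^sub>2" "\<forall>p. M\<^sub>2 p \<subseteq> M\<^sub>1 p"
      and bounds: "\<forall>p. Im_sub S \<epsilon> M p \<subseteq> M\<^sub>1 p" "\<forall>p. M\<^sub>2 p \<subseteq> Ker_sub S \<epsilon> M p"
    and iso: "isomorphic_pmod K Q (quot_pmod (restrict_pmod M M\<^sub>1) M\<^sub>2)"
    using assms(2) unfolding EN_def mem_Collect_eq by blast
  obtain f g where fg: "morphism K Q (quot_pmod (restrict_pmod M M\<^sub>1) M\<^sub>2) f"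
    "morphism K (quot_pmod (restrict_pmod M M\<^sub>1) M\<^sub>2) Q g"
    "mor_eq Q (mor_comp g f) mor_id"
    "mor_eq (quot_pmod (restrict_pmod M M\<^sub>1) M\<^sub>2) (mor_comp f g) mor_id"
    using iso unfolding isomorphic_pmod_def by blast
  have "subquotient K M M\<^sub>1 M\<^sub>2"
    using assms(1) sub by (simp add: subquotient_def)
  then show thesis
    using that[of M\<^sub>1 M\<^sub>2 f g] bounds fg by (simp add: mor_eq_def mor_comp_def mor_id_def)
qed

text \<open>Elements \<open>m\<close> and \<open>n\<close> are related if they represent the same element \<open>x\<close> of \<open>Q\<close>. If one of them is
  zero, injectivity of the isomorphisms gives \<open>x = 0\<close>, and the other lies in the denominator.\<close>

lemma (in poset_flow) common_erosion_imp_erosion_correspondence: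
  assumes M: "pmodule K M" and N: "pmodule K N" and nonneg: "0 \<le> \<epsilon>" "0 \<le> \<delta>"
    and QM: "Q \<in> EN K S \<epsilon> M" and QN: "Q \<in> EN K S \<delta> N"
  shows "\<exists>R. erosion_correspondence K M N R S \<epsilon> \<delta>"
proof -
  have Q: "pmodule K Q" using QM by (simp add: EN_def)
  obtain M\<^sub>1 M\<^sub>2 f f' where sM: "subquotient K M M\<^sub>1 M\<^sub>2"
    and boundM: "\<And>p. Im_sub S \<epsilon> M p \<subseteq> M\<^sub>1 p" "\<And>p. M\<^sub>2 p \<subseteq> Ker_sub S \<epsilon> M p"
    and f: "morphism K Q (quot_pmod (restrict_pmod M M\<^sub>1) M\<^sub>2) f"
    and f': "morphism K (quot_pmod (restrict_pmod M M\<^sub>1) M\<^sub>2) Q f'"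
    and f'f: "\<And>p x. x \<in> carrier (obj Q p) \<Longrightarrow> f' p (f p x) = x"
    and ff': "\<And>p X. X \<in> carrier (obj (quot_pmod (restrict_pmod M M\<^sub>1) M\<^sub>2) p) \<Longrightarrow> f p (f' p X) = X"
    using EN_D[OF M QM] by metis
  obtain N\<^sub>1 N\<^sub>2 g g' where sN: "subquotient K N N\<^sub>1 N\<^sub>2"
    and boundN: "\<And>p. Im_sub S \<delta> N p \<subseteq> N\<^sub>1 p" "\<And>p. N\<^sub>2 p \<subseteq> Ker_sub S \<delta> N p"
    and g: "morphism K Q (quot_pmod (restrict_pmod N N\<^sub>1) N\<^sub>2) g"
    and g': "morphism K (quot_pmod (restrict_pmod N N\<^sub>1) N\<^sub>2) Q g'"
    and g'g: "\<And>p x. x \<in> carrier (obj Q p) \<Longrightarrow> g' p (g p x) = x"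
    and gg': "\<And>p X. X \<in> carrier (obj (quot_pmod (restrict_pmod N N\<^sub>1) N\<^sub>2) p) \<Longrightarrow> g p (g' p X) = X"
    using EN_D[OF N QN] by metis
  interpret A: subquotient K M M\<^sub>1 M\<^sub>2 by (rule sM)
  interpret B: subquotient K N N\<^sub>1 N\<^sub>2 by (rule sN)
  define R where "R p = (\<Union>x\<in>carrier (obj Q p). f p x \<times> g p x)" for p
  note fc = morphismD(2)[OF f] and gc = morphismD(2)[OF g]
  note f_lin = linear_mapsD[OF morphismD(1)[OF f]] and g_lin = linear_mapsD[OF morphismD(1)[OF g]]
  have f_zero: "f p \<zero>\<^bsub>obj Q p\<^esub> = M\<^sub>2 p" for p
    using morphism_zero[OF Q A.pmodule_subquotient f] by (simp add: A.zero_subquotient)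
  have g_zero: "g p \<zero>\<^bsub>obj Q p\<^esub> = N\<^sub>2 p" for p
    using morphism_zero[OF Q B.pmodule_subquotient g] by (simp add: B.zero_subquotient)
  have zero_Q: "\<zero>\<^bsub>obj Q p\<^esub> \<in> carrier (obj Q p)" for p
    using pmoduleD(1)[OF Q, of p] module.axioms(2) abelian_group_def
      abelian_monoid.zero_closed by metis
  have R: "correspondence K M N R"
  proof unfold_locales
    fix p q m n m' n' a
    interpret Q: module K "obj Q p" by (rule pmoduleD(1)[OF Q])
    show "pmodule K M" by (fact M)
    show "pmodule K N" by (fact N)
    show "(\<zero>\<^bsub>obj M p\<^esub>, \<zero>\<^bsub>obj N p\<^esub>) \<in> R p"
      unfolding R_def using zero_Q A.zero_in_den[of p] B.zero_in_den[of p]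
      by (intro UN_I[of "\<zero>\<^bsub>obj Q p\<^esub>"]) (simp_all add: f_zero g_zero)
    { assume "(m, n) \<in> R p"
      then obtain x where x: "x \<in> carrier (obj Q p)" "m \<in> f p x" "n \<in> g p x"
        by (auto simp: R_def)
      then show "m \<in> carrier (obj M p)" "n \<in> carrier (obj N p)"
        using A.num_carrier[OF A.class_num[OF fc]] B.num_carrier[OF B.class_num[OF gc]] by auto
      { assume "(m', n') \<in> R p"
        then obtain y where y: "y \<in> carrier (obj Q p)" "m' \<in> f p y" "n' \<in> g p y"
          by (auto simp: R_def)
        have "m \<oplus>\<^bsub>obj M p\<^esub> m' \<in> f p (x \<oplus>\<^bsub>obj Q p\<^esub> y)"
          using A.class_add[OF fc[OF x(1)] x(2) fc[OF y(1)] y(2)] f_lin(2)[OF x(1) y(1)] by simp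
        moreover have "n \<oplus>\<^bsub>obj N p\<^esub> n' \<in> g p (x \<oplus>\<^bsub>obj Q p\<^esub> y)"
          using B.class_add[OF gc[OF x(1)] x(3) gc[OF y(1)] y(3)] g_lin(2)[OF x(1) y(1)] by simp
        ultimately show "(m \<oplus>\<^bsub>obj M p\<^esub> m', n \<oplus>\<^bsub>obj N p\<^esub> n') \<in> R p"
          unfolding R_def using Q.M.a_closed[OF x(1) y(1)] by blast }
      { assume a: "a \<in> carrier K"
        have "a \<odot>\<^bsub>obj M p\<^esub> m \<in> f p (a \<odot>\<^bsub>obj Q p\<^esub> x)"
          using A.class_smult[OF a fc[OF x(1)] x(2)] f_lin(3)[OF a x(1)] by simp
        moreover have "a \<odot>\<^bsub>obj N p\<^esub> n \<in> g p (a \<odot>\<^bsub>obj Q p\<^esub> x)"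
          using B.class_smult[OF a gc[OF x(1)] x(3)] g_lin(3)[OF a x(1)] by simp
        ultimately show "(a \<odot>\<^bsub>obj M p\<^esub> m, a \<odot>\<^bsub>obj N p\<^esub> n) \<in> R p"
          unfolding R_def using Q.smult_closed[OF a x(1)] by blast }
      { assume pq: "p \<le> q"
        have "arr M p q m \<in> f q (arr Q p q x)"
          using A.class_arr[OF pq fc[OF x(1)] x(2)] morphismD(3)[OF f pq x(1)] by simp
        moreover have "arr N p q n \<in> g q (arr Q p q x)"
          using B.class_arr[OF pq gc[OF x(1)] x(3)] morphismD(3)[OF g pq x(1)] by simp
        ultimately show "(arr M p q m, arr N p q n) \<in> R q"
          unfolding R_def using linear_mapsD(1)[OF pmoduleD(2)[OF Q pq] x(1)] by blast } }
  qed
  have "Im_sub S \<epsilon> M p \<subseteq> Domain (R p)" for p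
  proof
    fix m assume "m \<in> Im_sub S \<epsilon> M p"
    then have m: "m \<in> M\<^sub>1 p" using boundM(1) by blast
    then have X: "A.cls p m \<in> carrier (obj A.quot p)" by (simp add: A.carrier_subquotient)
    let ?x = "f' p (A.cls p m)"
    have x: "?x \<in> carrier (obj Q p)" using morphismD(2)[OF f' X] .
    obtain n where "n \<in> g p ?x" using B.class_nonempty[OF gc[OF x]] by blast
    moreover have "m \<in> f p ?x" using ff'[OF X] A.cls_self[OF m] by simp
    ultimately show "m \<in> Domain (R p)" unfolding R_def using x by blast
  qed
  moreover have "Im_sub S \<delta> N p \<subseteq> Range (R p)" for p
  proof
    fix n assume "n \<in> Im_sub S \<delta> N p"
    then have n: "n \<in> N\<^sub>1 p" using boundN(1) by blast
    then have X: "B.cls p n \<in> carrier (obj B.quot p)" by (simp add: B.carrier_subquotient)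
    let ?x = "g' p (B.cls p n)"
    have x: "?x \<in> carrier (obj Q p)" using morphismD(2)[OF g' X] .
    obtain m where "m \<in> f p ?x" using A.class_nonempty[OF fc[OF x]] by blast
    moreover have "n \<in> g p ?x" using gg'[OF X] B.cls_self[OF n] by simp
    ultimately show "n \<in> Range (R p)" unfolding R_def using x by blast
  qed
  moreover have "m \<in> Ker_sub S \<epsilon> M p" if mR: "(m, \<zero>\<^bsub>obj N p\<^esub>) \<in> R p" for m p
  proof -
    obtain x where x: "x \<in> carrier (obj Q p)" "m \<in> f p x" "\<zero>\<^bsub>obj N p\<^esub> \<in> g p x"
      using mR by (auto simp: R_def)
    have "g p x = g p \<zero>\<^bsub>obj Q p\<^esub>" using B.class_zero[OF gc[OF x(1)] x(3)] g_zero by simp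
    then have "x = \<zero>\<^bsub>obj Q p\<^esub>" using g'g x(1) zero_Q by metis
    then show ?thesis using x(2) f_zero boundM(2) by blast
  qed
  moreover have "n \<in> Ker_sub S \<delta> N p" if nR: "(\<zero>\<^bsub>obj M p\<^esub>, n) \<in> R p" for n p
  proof -
    obtain x where x: "x \<in> carrier (obj Q p)" "\<zero>\<^bsub>obj M p\<^esub> \<in> f p x" "n \<in> g p x"
      using nR by (auto simp: R_def)
    have "f p x = f p \<zero>\<^bsub>obj Q p\<^esub>" using A.class_zero[OF fc[OF x(1)] x(2)] f_zero by simp
    then have "x = \<zero>\<^bsub>obj Q p\<^esub>" using f'f x(1) zero_Q by metis
    then show ?thesis using x(3) g_zero boundN(2) by blast
  qed
  ultimately have "erosion_correspondence K M N R S \<epsilon> \<delta>"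
    using R nonneg poset_flow_axioms
    by (simp add: erosion_correspondence_def erosion_correspondence_axioms_def)
  then show ?thesis by blast
qed

section \<open>Comparison of the distances\<close>

lemma (in poset_flow) interleaved_imp_common_erosion:
  fixes M :: "('p, 'k, 'a) pmod"
  assumes "pmodule K M" "pmodule K N" "interleaved K S \<epsilon> M N"
  shows "\<exists>Q :: ('p, 'k, 'a set) pmod. Q \<in> EN K S \<epsilon> M \<and> Q \<in> EN K S \<epsilon> N"
  using interleaved_imp_erosion_correspondence[OF assms] erosion_correspondence.common_erosion
  by blast

lemma (in poset_flow) common_erosion_imp_interleaved:
  assumes "pmodule K M" "pmodule K N" "0 \<le> \<epsilon>" "0 \<le> \<delta>" "Q \<in> EN K S \<epsilon> M" "Q \<in> EN K S \<delta> N"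
  shows "interleaved K S (\<epsilon> + \<delta>) M N"
  using common_erosion_imp_erosion_correspondence[OF assms] erosion_correspondence.interleaved_sum
  by blast

lemma (in poset_flow) d_EN_le_d_I:
  assumes "pmodule K M" "pmodule K N"
  shows "d_EN K S M N \<le> d_I K S M N"
  unfolding d_EN_def d_I_def
  using interleaved_imp_common_erosion[OF assms]
  by (intro INF_superset_mono) (auto simp: interleaved_def)

lemma (in poset_flow) d_I_le_d_EN:
  fixes M :: "('p, 'k, 'a) pmod"
  assumes "pmodule K M" "pmodule K N"
  shows "d_I K S M N \<le> 2 * d_EN K S M N"
proof -
  \<comment> \<open>Halving the left-hand side turns the claim into a lower bound for an infimum.\<close>
  have "d_I K S M N / 2 \<le> d_EN K S M N"
    unfolding d_EN_def
  proof (rule INF_greatest)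
    fix \<epsilon> assume "\<epsilon> \<in> {\<epsilon>. 0 \<le> \<epsilon> \<and>
      (\<exists>Q :: ('p, 'k, 'a set) pmod. Q \<in> EN K S \<epsilon> M \<and> Q \<in> EN K S \<epsilon> N)}"
    then have \<epsilon>: "0 \<le> \<epsilon>" and "interleaved K S (\<epsilon> + \<epsilon>) M N"
      using common_erosion_imp_interleaved[OF assms] by blast+
    then have "d_I K S M N \<le> ennreal (\<epsilon> + \<epsilon>)"
      unfolding d_I_def by (intro INF_lower) simp
    also have "\<dots> = ennreal \<epsilon> * 2" using ennreal_plus[OF \<epsilon> \<epsilon>] by (simp only: mult_2_right)
    finally have "d_I K S M N / 2 \<le> ennreal \<epsilon> * 2 / 2"
      by (rule divide_right_mono_ennreal)
    then show "d_I K S M N / 2 \<le> ennreal \<epsilon>" by (simp add: ennreal_mult_divide_eq)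
  qed
  then have "2 * (d_I K S M N / 2) \<le> 2 * d_EN K S M N" by (rule mult_left_mono) simp
  moreover have "2 * (d_I K S M N / 2) = d_I K S M N"
    by (simp add: ennreal_times_divide mult.commute[of 2] ennreal_mult_divide_eq)
  ultimately show ?thesis by simp
qed

theorem theorem4p7:
  fixes K :: "('k, 'm) ring_scheme"
    and S :: "real \<Rightarrow> 'p::order \<Rightarrow> 'p"
    and M :: "('p, 'k, 'a) pmod"
    and N :: "('p, 'k, 'b) pmod"
  assumes "Ring.field K" and "poset_flow S" and "pmodule K M" and "pmodule K N"
  shows "d_EN K S M N \<le> d_I K S M N
    \<and> d_I K S M N \<le> 2 * d_EN K S M N
    \<and> (\<forall>\<epsilon>\<ge>0. interleaved K S \<epsilon> M N \<longrightarrow>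
        (\<exists>Q :: ('p, 'k, 'a set) pmod. Q \<in> EN K S \<epsilon> M \<and> Q \<in> EN K S \<epsilon> N))
    \<and> (\<forall>\<epsilon>\<ge>0. \<forall>\<delta>\<ge>0.
        (\<exists>Q :: ('p, 'k, 'c) pmod. Q \<in> EN K S \<epsilon> M \<and> Q \<in> EN K S \<delta> N) \<longrightarrow>
        interleaved K S (\<epsilon> + \<delta>) M N)"
proof -
  interpret poset_flow S by fact
  show ?thesis
    using d_EN_le_d_I[OF assms(3,4)] d_I_le_d_EN[OF assms(3,4)]
      interleaved_imp_common_erosion[OF assms(3,4)] common_erosion_imp_interleaved[OF assms(3,4)]
    by blast
qed

end
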